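(* Fix an integer $n\ge1$ and $c>0$. For $\mu$-almost every $\Lambda\in X$, \[\#(F_{T,c}\cap\Lambda)\sim|F_{T,c}|\quad\text{as }T\to\infty.\]
   Context: Let $\mathcal Q(\mathbf x)=\sum_{i=1}^{n+1}x_i^2-x_{n+2}^2$ on $\mathbb R^{n+2}$, $\mathcal L=\{\mathbf x\in\mathbb R^{n+2}:\mathcal Q(\mathbf x)=0,\ x_{n+2}\ge0\}$, and $G=\mathrm{SO}(\mathcal Q)^\circ$, acting linearly on $\mathcal L$. Let $\Lambda_0=\mathcal L\cap(\mathbb Z^{n+1}\times\mathbb Z_{>0})$, $\Gamma$ the stabilizer of $\Lambda_0$ in $G$, and $X=G/\Gamma$, identified with $\{g\Lambda_0:g\in G\}$; $\mu$ is the $G$-invariant probability measure on $X$. For $f\in L^1(\mathcal L)$, $\widehat f(\Lambda)=\sum_{\mathbf v\in\Lambda\setminus\{\mathbf 0\}}f(\mathbf v)$. Let $\lambda$ be the $G$-invariant measure on $\mathcal L$ normalized so that $\int_X\widehat f\,d\mu=\int_{\mathcal L}f\,d\lambda$ for all $f\in L^1(\mathcal L,\lambda)$; $|E|=\lambda(E)$. Define $F_{T,c}=\{\mathbf x\in\mathcal L:\ x_{n+2}^2-x_{n+1}^2<c^2,\ 1\le x_{n+2}+x_{n+1}<e^T\}$. $f(T)\sim g(T)$ means $f(T)/g(T)\to1$. *)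

theory Defs
  imports "HOL-Probability.Probability"
begin

text \<open>
  The dimension parameter \<open>n \<ge> 1\<close> is \<open>CARD('n)\<close> for a finite type \<open>'n\<close>, and \<open>\<real>\<^sup>n\<^sup>+\<^sup>2\<close> is
  the type \<open>real ^ 'n option option\<close>.  The coordinate \<open>x\<^sub>n\<^sub>+\<^sub>2\<close> is \<open>x $ None\<close>, the coordinate
  \<open>x\<^sub>n\<^sub>+\<^sub>1\<close> is \<open>x $ Some None\<close>, and \<open>x\<^sub>1, \<dots>, x\<^sub>n\<close> are the \<open>x $ Some (Some i)\<close>.
\<close>

type_synonym 'n vec2 = "real ^ 'n option option"
type_synonym 'n mat2 = "real ^ 'n option option ^ 'n option option"

definition Qform :: "'n::finite vec2 \<Rightarrow> real" where
  "Qform x = (\<Sum>i\<in>UNIV. (x $ Some i)\<^sup>2) - (x $ None)\<^sup>2"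

definition light_cone :: "'n::finite vec2 set" where
  "light_cone = {x. Qform x = 0 \<and> x $ None \<ge> 0}"

definition SO_Q :: "'n::finite mat2 set" where
  "SO_Q = {A. det A = 1 \<and> (\<forall>x. Qform (A *v x) = Qform x)}"

definition G_Q :: "'n::finite mat2 set" where
  "G_Q = connected_component_set SO_Q (mat 1)"

definition Lambda0 :: "'n::finite vec2 set" where
  "Lambda0 = {x \<in> light_cone. (\<forall>i. x $ i \<in> \<int>) \<and> x $ None > 0}"

definition translate :: "'n::finite mat2 \<Rightarrow> 'n vec2 set \<Rightarrow> 'n vec2 set" where
  "translate g S = (\<lambda>v. g *v v) ` S"

definition Gamma_Q :: "'n::finite mat2 set" where
  "Gamma_Q = {g \<in> G_Q. translate g Lambda0 = Lambda0}"

text \<open>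
  The homogeneous space \<open>X = G/\<Gamma_Q>\<close> is realised as the orbit of \<open>\<Lambda>\<^sub>0\<close>; the fibres of
  \<open>g \<mapsto> g\<Lambda>\<^sub>0\<close> are the cosets \<open>g\<Gamma_Q>\<close> (lemma \<open>translate_Lambda0_eq_iff\<close>), and its topology is the
  quotient topology (lemma \<open>quotient_map_X_top\<close>).
\<close>

definition X_space :: "'n::finite vec2 set set" where
  "X_space = (\<lambda>g. translate g Lambda0) ` G_Q"

definition X_top :: "'n::finite vec2 set topology" where
  "X_top = topology (\<lambda>U. U \<subseteq> X_space \<and>
     openin (top_of_set G_Q) {g \<in> G_Q. translate g Lambda0 \<in> U})"

definition X_borel :: "'n::finite vec2 set measure" where
  "X_borel = sigma X_space {U. openin X_top U}"

definition invariant_measure ::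
  "'g set \<Rightarrow> ('g \<Rightarrow> 'a \<Rightarrow> 'a) \<Rightarrow> 'a measure \<Rightarrow> bool" where
  "invariant_measure H act M \<longleftrightarrow>
     (\<forall>g\<in>H. \<forall>A\<in>sets M. act g ` A \<in> sets M \<and> emeasure M (act g ` A) = emeasure M A)"

definition invariant_prob_X :: "'n::finite vec2 set measure \<Rightarrow> bool" where
  "invariant_prob_X mu \<longleftrightarrow>
     prob_space mu \<and> sets mu = sets X_borel \<and> invariant_measure G_Q translate mu"

text \<open>Invariant measures on the cone are understood to be Radon: Borel and finite on compact sets.\<close>

definition invariant_radon_cone :: "'n::finite vec2 measure \<Rightarrow> bool" where
  "invariant_radon_cone lam \<longleftrightarrow>
     sets lam = sets (restrict_space borel light_cone) \<and>
     (\<forall>K. compact K \<longrightarrow> K \<subseteq> light_cone \<longrightarrow> emeasure lam K < \<infinity>) \<and>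
     invariant_measure G_Q (*v) lam"

definition siegel_transform :: "('n::finite vec2 \<Rightarrow> real) \<Rightarrow> 'n vec2 set \<Rightarrow> real" where
  "siegel_transform f L = (\<Sum>\<^sub>\<infinity>v\<in>L - {0}. f v)"

text \<open>
  The Bochner integral of a non-integrable function is \<open>0\<close> by convention, so the integrability
  of the Siegel transform, which is part of the mean value formula, has to be demanded explicitly.
\<close>

definition siegel_normalized ::
  "'n::finite vec2 set measure \<Rightarrow> 'n vec2 measure \<Rightarrow> bool" where
  "siegel_normalized mu lam \<longleftrightarrow>
     (\<forall>f. integrable lam f \<longrightarrow>
        integrable mu (siegel_transform f) \<and>
        (\<integral>L. siegel_transform f L \<partial>mu) = (\<integral>v. f v \<partial>lam))"

definition F_set :: "real \<Rightarrow> real \<Rightarrow> 'n::finite vec2 set" where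
  "F_set T c = {x \<in> light_cone.
     (x $ None)\<^sup>2 - (x $ Some None)\<^sup>2 < c\<^sup>2 \<and>
     1 \<le> x $ None + x $ Some None \<and> x $ None + x $ Some None < exp T}"

lemma translate_mult: "translate (g ** h) S = translate g (translate h S)"
  by (simp add: translate_def image_image matrix_vector_mul_assoc)

lemma translate_one [simp]: "translate (mat 1) S = S"
  by (simp add: translate_def)

lemma one_in_SO_Q: "mat 1 \<in> SO_Q"
  by (simp add: SO_Q_def)

lemma SO_Q_mult: "A \<in> SO_Q \<Longrightarrow> B \<in> SO_Q \<Longrightarrow> A ** B \<in> SO_Q"
  by (simp add: SO_Q_def det_mul flip: matrix_vector_mul_assoc)

lemma SO_Q_inverse:
  assumes "A \<in> SO_Q"
  obtains B where "B \<in> SO_Q" "A ** B = mat 1" "B ** A = mat 1"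
proof -
  have "det A = 1" using assms by (simp add: SO_Q_def)
  then obtain B where B: "A ** B = mat 1" "B ** A = mat 1"
    using invertible_det_nz[of A] by (auto simp: invertible_def)
  have "det B = 1"
    using \<open>det A = 1\<close> B(1) det_mul[of A B] by simp
  moreover have "Qform (B *v x) = Qform x" for x
  proof -
    have "Qform (B *v x) = Qform (A *v (B *v x))"
      using assms by (simp add: SO_Q_def)
    then show ?thesis by (simp add: matrix_vector_mul_assoc B)
  qed
  ultimately have "B \<in> SO_Q" by (simp add: SO_Q_def)
  with B that show ?thesis by blast
qed

lemma one_in_G_Q: "mat 1 \<in> G_Q"
  by (simp add: G_Q_def one_in_SO_Q)

lemma G_Q_subset: "G_Q \<subseteq> SO_Q"
  unfolding G_Q_def by (rule connected_component_subset)

lemma connected_left_mult: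
  fixes S :: "'n::finite mat2 set"
  assumes "connected S"
  shows "connected ((\<lambda>h. A ** h) ` S)"
proof -
  have "continuous_on S (\<lambda>h. A ** h)"
    unfolding matrix_matrix_mult_def by (intro continuous_intros)
  then show ?thesis
    using assms by (rule connected_continuous_image)
qed

lemma G_Q_left_mult:
  assumes "A \<in> SO_Q" "g \<in> G_Q" "A ** g = mat 1" "h \<in> G_Q"
  shows "A ** h \<in> G_Q"
proof -
  let ?S = "(\<lambda>h. A ** h) ` G_Q"
  have conn: "connected ?S"
    by (rule connected_left_mult) (simp add: G_Q_def)
  have sub: "?S \<subseteq> SO_Q"
    using assms(1) G_Q_subset SO_Q_mult by blast
  have "mat 1 \<in> ?S" using assms(2,3) by (metis imageI)
  then have "?S \<subseteq> G_Q"
    unfolding G_Q_def using conn sub by (intro connected_component_maximal) (auto simp: G_Q_def)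
  with assms(4) show ?thesis by blast
qed

lemma translate_Lambda0_eq_iff:
  fixes g h :: "'n::finite mat2"
  assumes "g \<in> G_Q" "h \<in> G_Q"
  shows "translate g Lambda0 = translate h Lambda0 \<longleftrightarrow> (\<exists>k\<in>Gamma_Q. h = g ** k)"
proof
  assume eq: "translate g Lambda0 = translate h Lambda0"
  obtain B where B: "B \<in> SO_Q" "g ** B = mat 1" "B ** g = mat 1"
    using SO_Q_inverse assms(1) G_Q_subset by blast
  have "B ** h \<in> G_Q"
    using G_Q_left_mult[OF B(1) assms(1) B(3) assms(2)] .
  moreover have "translate (B ** h) Lambda0 = (Lambda0 :: 'n vec2 set)"
    by (metis B(3) eq translate_mult translate_one)
  ultimately have "B ** h \<in> Gamma_Q" by (simp add: Gamma_Q_def)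
  moreover have "h = g ** (B ** h)"
    by (simp add: matrix_mul_assoc B)
  ultimately show "\<exists>k\<in>Gamma_Q. h = g ** k" by blast
next
  assume "\<exists>k\<in>Gamma_Q. h = g ** k"
  then show "translate g Lambda0 = translate h Lambda0"
    by (auto simp: Gamma_Q_def translate_mult)
qed

lemma openin_X_top:
  fixes U :: "'n::finite vec2 set set"
  shows "openin X_top U \<longleftrightarrow> U \<subseteq> X_space \<and>
     openin (top_of_set G_Q) {g \<in> G_Q. translate g Lambda0 \<in> U}"
proof -
  have "istopology (\<lambda>U. U \<subseteq> (X_space :: 'n vec2 set set) \<and>
     openin (top_of_set G_Q) {g \<in> G_Q. translate g Lambda0 \<in> U})"
    unfolding istopology_def
  proof (intro conjI allI impI)
    fix S T :: "'n vec2 set set"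
    assume S: "S \<subseteq> X_space \<and> openin (top_of_set G_Q) {g \<in> G_Q. translate g Lambda0 \<in> S}"
      and T: "T \<subseteq> X_space \<and> openin (top_of_set G_Q) {g \<in> G_Q. translate g Lambda0 \<in> T}"
    then show "S \<inter> T \<subseteq> X_space" by blast
    have "{g \<in> G_Q. translate g Lambda0 \<in> S \<inter> T} =
        {g \<in> G_Q. translate g Lambda0 \<in> S} \<inter> {g \<in> G_Q. translate g Lambda0 \<in> T}"
      by blast
    then show "openin (top_of_set G_Q) {g \<in> G_Q. translate g Lambda0 \<in> S \<inter> T}"
      using openin_Int[of "top_of_set G_Q" "{g \<in> G_Q. translate g Lambda0 \<in> S}"
          "{g \<in> G_Q. translate g Lambda0 \<in> T}"] S T by presburger
  next
    fix K :: "'n vec2 set set set"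
    assume K: "\<forall>U\<in>K. U \<subseteq> X_space \<and>
      openin (top_of_set G_Q) {g \<in> G_Q. translate g Lambda0 \<in> U}"
    then show "\<Union>K \<subseteq> X_space" by blast
    have "{g \<in> G_Q. translate g Lambda0 \<in> \<Union>K} =
        (\<Union>U\<in>K. {g \<in> G_Q. translate g Lambda0 \<in> U})"
      by blast
    moreover have "openin (top_of_set G_Q) (\<Union>U\<in>K. {g \<in> G_Q. translate g Lambda0 \<in> U})"
      using K by (intro openin_Union) auto
    ultimately show "openin (top_of_set G_Q) {g \<in> G_Q. translate g Lambda0 \<in> \<Union>K}"
      by simp
  qed
  then show ?thesis
    unfolding X_top_def by (subst topology_inverse') (assumption, rule refl)
qed

lemma topspace_X_top: "topspace X_top = (X_space :: 'n::finite vec2 set set)"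
proof
  show "topspace X_top \<subseteq> (X_space :: 'n vec2 set set)"
    using openin_X_top openin_topspace by blast
  have eq: "{g \<in> G_Q. translate g Lambda0 \<in> X_space} = (G_Q :: 'n mat2 set)"
    by (auto simp: X_space_def)
  have "openin X_top (X_space :: 'n vec2 set set)"
    unfolding openin_X_top eq by simp
  then show "(X_space :: 'n vec2 set set) \<subseteq> topspace X_top"
    by (rule openin_subset)
qed

lemma quotient_map_X_top:
  "quotient_map (top_of_set G_Q) X_top (\<lambda>g. translate g Lambda0)"
  unfolding quotient_map_def
  by (auto simp: topspace_X_top openin_X_top X_space_def)

end

theory Submission
  imports Defs
begin

text \<open>
  In the coordinates \<open>p = x\<^sub>n\<^sub>+\<^sub>2 + x\<^sub>n\<^sub>+\<^sub>1\<close>, \<open>q = x\<^sub>n\<^sub>+\<^sub>2 - x\<^sub>n\<^sub>+\<^sub>1\<close>, \<open>y = (x\<^sub>1, \<dots>, x\<^sub>n)\<close> the cone is \<open>|y|\<^sup>2 = p q\<close> and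
  \<open>F\<^sub>T\<^sub>,\<^sub>c\<close> is \<open>|y| < c\<close>, \<open>1 \<le> p < e\<^sup>T\<close>.  The boost \<open>(p, q, y) \<mapsto> (e\<^sup>t p, e\<^sup>-\<^sup>t q, y)\<close> cuts \<open>F\<^sub>N\<^sub>,\<^sub>c\<close> into
  \<open>N\<close> translates of \<open>F\<^sub>1\<^sub>,\<^sub>c\<close>, so the counts are Birkhoff sums of the Siegel transform of the indicator
  of \<open>F\<^sub>1\<^sub>,\<^sub>c\<close>, whose mean is \<open>|F\<^sub>1\<^sub>,\<^sub>c|\<close>.  Instead of proving ergodicity of the boost, Hopf's argument is applied
  directly to these sums.  By the maximal ergodic theorem forward and backward densities agree
  almost everywhere.  Up to an arbitrarily small change of \<open>c\<close>, the forward density does not change under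
  elements fixing the ray \<open>y = q = 0\<close>, and the backward density does not change under the opposite
  shears \<open>y \<mapsto> y + p b\<close>.  Almost every ray is moved to that fixed one by a shear, and \<open>G\<close> acts on the shear
  parameters by Moebius maps, which preserve null sets; with Fubini's theorem this gives comparable
  densities at any two generic points of the single orbit \<open>X\<close>.
\<close>

section \<open>Ergodic averages\<close>

text \<open>Applied to \<open>s N = a N - \<beta> * real N\<close>, this lies between limsup a(N)/N
  > \<beta> and limsup a(N)/N >= \<beta>, so densities are compared without forming limits. The
  bounds \<open>K\<close> are natural numbers so that measurability needs only countable
  operations.\<close>

definition unbounded_above :: "(nat \<Rightarrow> real) \<Rightarrow> bool" where
  "unbounded_above s \<longleftrightarrow> (\<forall>K::nat. \<exists>N. real K < s N)"

lemma unb_imp_pos: "unbounded_above s \<Longrightarrow> \<exists>N. 0 < s N"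
  unfolding unbounded_above_def by (metis of_nat_0)

text \<open>The comparison behind the later transfers of densities: a bounded error \<open>C\<close>
  and a bounded delay \<open>k\<close> do no harm.\<close>

lemma unb_shift_le:
  assumes "unbounded_above s" and "\<And>N. s N \<le> C + r (N + k)"
  shows "unbounded_above r"
  unfolding unbounded_above_def
proof
  fix K :: nat
  obtain L :: nat where L: "real K + C \<le> real L" using real_arch_simple by blast
  obtain N where "real L < s N" using assms(1) by (auto simp: unbounded_above_def)
  then have "real K < r (N + k)" using assms(2)[of N] L by linarith
  then show "\<exists>N. real K < r N" by blast
qed

lemma unb_Suc_shift:
  assumes "\<And>N. s (Suc N) = C + r N"
  shows "unbounded_above s \<longleftrightarrow> unbounded_above r"
proof
  assume "unbounded_above r"
  show "unbounded_above s"
    by (rule unb_shift_le[OF \<open>unbounded_above r\<close>, of "- C" s 1]) (use assms in auto)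
next
  assume s: "unbounded_above s"
  show "unbounded_above r"
    unfolding unbounded_above_def
  proof
    fix K :: nat
    \<comment> \<open>\<open>L\<close> also dominates \<open>s 0\<close>, so the witness
      \<open>N\<close> below is a successor.\<close>
    obtain L :: nat where L: "max (s 0) (real K + C) \<le> real L" using real_arch_simple by blast
    obtain N where N: "real L < s N" using s by (auto simp: unbounded_above_def)
    then obtain N' where "N = Suc N'" using L by (cases N) auto
    then have "real K < r N'" using assms[of N'] N L by simp
    then show "\<exists>N. real K < r N" by blast
  qed
qed

section \<open>Orbit sums and the maximal ergodic theorem\<close>

definition orbit_sum :: "('a \<Rightarrow> 'a) \<Rightarrow> ('a \<Rightarrow> real) \<Rightarrow> nat \<Rightarrow> 'a \<Rightarrow> real" where
  "orbit_sum T f N x = (\<Sum>k<N. f ((T ^^ k) x))"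

lemma orbit_sum_0 [simp]: "orbit_sum T f 0 x = 0"
  by (simp add: orbit_sum_def)

lemma orbit_sum_Suc: "orbit_sum T f (Suc N) x = f x + orbit_sum T f N (T x)"
  unfolding orbit_sum_def by (subst sum.lessThan_Suc_shift) (simp add: funpow_swap1)

text \<open>This is the maximum of the orbit sums of lengths 0 to \<open>N\<close>, written in the
  form that compares it with its composition with \<open>T\<close>.\<close>

primrec orbit_max :: "('a \<Rightarrow> 'a) \<Rightarrow> ('a \<Rightarrow> real) \<Rightarrow> nat \<Rightarrow> 'a \<Rightarrow> real" where
  "orbit_max T f 0 x = 0"
| "orbit_max T f (Suc N) x = max 0 (f x + orbit_max T f N (T x))"

lemma orbit_max_nonneg: "0 \<le> orbit_max T f N x"
  by (cases N) auto

lemma orbit_max_mono: "orbit_max T f N x \<le> orbit_max T f (Suc N) x"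
proof (induction N arbitrary: x)
  case (Suc N)
  have "max 0 (f x + orbit_max T f N (T x)) \<le> max 0 (f x + orbit_max T f (Suc N) (T x))"
    by (intro max.mono add_left_mono Suc order_refl)
  then show ?case by (simp only: orbit_max.simps(2)[of T f _ x])
qed simp

lemma orbit_sum_le_max: "orbit_sum T f N x \<le> orbit_max T f N x"
  by (induction N arbitrary: x) (auto simp: orbit_sum_Suc intro: max.coboundedI2)

locale measure_preserving_map = prob_space M for M :: "'a measure" +
  fixes T :: "'a \<Rightarrow> 'a"
  assumes T_measurable [measurable]: "T \<in> M \<rightarrow>\<^sub>M M"
    and distr_T: "distr M M T = M"
begin

lemma integrable_comp_T:
  fixes f :: "'a \<Rightarrow> real"
  assumes "integrable M f"
  shows "integrable M (\<lambda>x. f (T x))"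
  by (rule integrable_distr[OF T_measurable]) (simp add: distr_T assms)

lemma integral_comp_T:
  fixes f :: "'a \<Rightarrow> real"
  assumes "f \<in> borel_measurable M"
  shows "(\<integral>x. f (T x) \<partial>M) = (\<integral>x. f x \<partial>M)"
  using integral_distr[OF T_measurable assms] by (simp add: distr_T)

lemma integrable_orbit_max:
  assumes "integrable M f"
  shows "integrable M (orbit_max T f N)"
proof (induction N)
  case (Suc N)
  have "integrable M (\<lambda>x. max 0 (f x + orbit_max T f N (T x)))"
    using assms integrable_comp_T[OF Suc] by (intro integrable_max) auto
  then show ?case by (simp add: fun_eq_iff[symmetric] cong: integrable_cong)
qed (simp add: fun_eq_iff[symmetric] cong: integrable_cong)

text \<open>Garsia's argument: where the maximal sum \<open>m\<close> is positive, \<open>f \<ge> m - m \<circ> T\<close>.\<close>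

lemma integral_orbit_max_pos:
  assumes f: "integrable M f"
  shows "0 \<le> (\<integral>x. (if 0 < orbit_max T f (Suc N) x then f x else 0) \<partial>M)"
proof -
  let ?m = "orbit_max T f (Suc N)"
  have m: "integrable M ?m" by (rule integrable_orbit_max[OF f])
  then have [measurable]: "?m \<in> borel_measurable M" by blast
  have [measurable]: "f \<in> borel_measurable M" using f by blast
  have D: "{x \<in> space M. 0 < ?m x} \<in> sets M" by measurable
  have "0 = (\<integral>x. ?m x - ?m (T x) \<partial>M)"
    using m integrable_comp_T[OF m] by (subst Bochner_Integration.integral_diff) (auto simp: integral_comp_T simp del: orbit_max.simps)
  also have "\<dots> \<le> (\<integral>x. (if 0 < ?m x then f x else 0) \<partial>M)"
  proof (rule integral_mono)
    show "integrable M (\<lambda>x. ?m x - ?m (T x))"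
      using m integrable_comp_T[OF m] by (rule Bochner_Integration.integrable_diff)
    have "integrable M (\<lambda>x. indicator {x\<in>space M. 0 < ?m x} x *\<^sub>R f x)"
      by (rule integrable_mult_indicator[OF D f])
    then show "integrable M (\<lambda>x. if 0 < ?m x then f x else 0)"
      by (rule Bochner_Integration.integrable_cong[THEN iffD1, rotated 2]) (auto simp: indicator_def)
    fix x
    show "?m x - ?m (T x) \<le> (if 0 < ?m x then f x else 0)"
      using orbit_max_mono[of T f N "T x"] orbit_max_nonneg[of T f "Suc N" "T x"]
      by (auto simp: max_def split: if_splits)
  qed
  finally show ?thesis .
qed

text \<open>Garsia's inequality is applied to \<open>indicator A x * f x\<close>. Invariance of
  \<open>A\<close> makes its orbit sums equal to those of \<open>f\<close> on \<open>A\<close>, so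
  the maxima eventually become positive at each point of \<open>A\<close>, while off
  \<open>A\<close> the integrand is 0; dominated convergence concludes.\<close>

lemma maximal_ergodic:
  assumes f: "integrable M f"
    and A [measurable]: "A \<in> sets M" and inv: "\<And>x. x \<in> space M \<Longrightarrow> T x \<in> A \<longleftrightarrow> x \<in> A"
    and pos: "\<And>x. x \<in> A \<Longrightarrow> \<exists>N. 0 < orbit_sum T f N x"
  shows "0 \<le> (\<integral>x. indicator A x * f x \<partial>M)"
proof -
  define g where "g x = indicator A x * f x" for x
  have [measurable]: "f \<in> borel_measurable M" using f by blast
  have g: "integrable M g"
    using integrable_mult_indicator[OF A f] by (simp add: g_def[abs_def])
  have eq: "orbit_sum T g N x = indicator A x * orbit_sum T f N x" if "x \<in> space M" for N x
    using that
  proof (induction N arbitrary: x)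
    case (Suc N)
    have "T x \<in> space M" using measurable_space[OF T_measurable Suc.prems] .
    with Suc inv[OF Suc.prems] show ?case
      by (auto simp: orbit_sum_Suc g_def algebra_simps indicator_def)
  qed simp
  have lim: "(\<lambda>N. \<integral>x. (if 0 < orbit_max T g (Suc N) x then g x else 0) \<partial>M) \<longlonglongrightarrow> (\<integral>x. g x \<partial>M)"
  proof (rule integral_dominated_convergence[where w = "\<lambda>x. norm (g x)"])
    fix N
    have [measurable]: "orbit_max T g N \<in> borel_measurable M" "g \<in> borel_measurable M" for N
      using integrable_orbit_max[OF g] g by blast+
    show "(\<lambda>x. if 0 < orbit_max T g (Suc N) x then g x else 0) \<in> borel_measurable M"
      by measurable
  next
    show "AE x in M. (\<lambda>N. if 0 < orbit_max T g (Suc N) x then g x else 0) \<longlonglongrightarrow> g x"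
    proof (rule AE_I2)
      fix x assume x: "x \<in> space M"
      show "(\<lambda>N. if 0 < orbit_max T g (Suc N) x then g x else 0) \<longlonglongrightarrow> g x"
      proof (cases "x \<in> A")
        case True
        then obtain N where N: "0 < orbit_max T g N x"
          using pos[OF True] eq[OF x] orbit_sum_le_max[of T g _ x] by (auto intro: less_le_trans)
        have "0 < orbit_max T g (Suc m) x" if "m \<ge> N" for m
          using N lift_Suc_mono_le[of "\<lambda>n. orbit_max T g n x" N "Suc m"] orbit_max_mono[of T g _ x] that
          by fastforce
        then have "\<forall>\<^sub>F m in sequentially. (if 0 < orbit_max T g (Suc m) x then g x else 0) = g x"
          by (auto simp: eventually_sequentially simp del: orbit_max.simps)
        then show ?thesis by (rule tendsto_eventually)
      next
        case False
        then have "(if b then g x else 0) = g x" for b by (simp add: g_def)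
        then show ?thesis by (simp only: tendsto_const)
      qed
    qed
  qed (use g in auto)
  have "0 \<le> (\<integral>x. g x \<partial>M)"
    by (rule LIMSEQ_le_const[OF lim]) (use integral_orbit_max_pos[OF g] in blast)
  then show ?thesis by (simp add: g_def)
qed

lemma measurable_unb_orbit_sum [measurable]:
  assumes [measurable]: "f \<in> borel_measurable M"
  shows "Measurable.pred M (\<lambda>x. unbounded_above (\<lambda>N. orbit_sum T f N x))"
  unfolding unbounded_above_def orbit_sum_def by measurable

lemma unb_orbit_sum_T:
  "unbounded_above (\<lambda>N. orbit_sum T f N (T x)) \<longleftrightarrow> unbounded_above (\<lambda>N. orbit_sum T f N x)"
  by (rule unb_Suc_shift[symmetric, of _ "f x"]) (simp add: orbit_sum_Suc)

text \<open>The set where the sums are unbounded is \<open>T\<close>-invariant, has full measure and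
  carries a positive orbit sum at each point, so \<open>maximal_ergodic\<close> applies to
  it.\<close>

lemma integral_nonneg_of_unb:
  assumes f: "integrable M f" and "AE x in M. unbounded_above (\<lambda>N. orbit_sum T f N x)"
  shows "0 \<le> (\<integral>x. f x \<partial>M)"
proof -
  have [measurable]: "f \<in> borel_measurable M" using f by blast
  let ?A = "{x \<in> space M. unbounded_above (\<lambda>N. orbit_sum T f N x)}"
  have A: "?A \<in> sets M" by measurable
  have "0 \<le> (\<integral>x. indicator ?A x * f x \<partial>M)"
    using f A
  proof (rule maximal_ergodic)
    fix x assume "x \<in> space M"
    then show "T x \<in> ?A \<longleftrightarrow> x \<in> ?A"
      using measurable_space[OF T_measurable] by (auto simp: unb_orbit_sum_T)
  qed (auto intro: unb_imp_pos)
  also have "\<dots> = (\<integral>x. f x \<partial>M)"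
    using assms(2) A by (intro integral_cong_AE) (auto simp: indicator_def)
  finally show ?thesis .
qed

end

text \<open>The pointwise ergodic theorem in the form needed for Hopf's argument: forward and backward
  averages of an integrable function cannot separate on a set of positive measure.\<close>

lemma forward_backward_unb:
  assumes T: "measure_preserving_map M T" and S: "measure_preserving_map M S"
    and ST: "\<And>x. x \<in> space M \<Longrightarrow> S (T x) = x" and TS: "\<And>x. x \<in> space M \<Longrightarrow> T (S x) = x"
    and f: "integrable M f" and g: "integrable M g"
    and fg: "\<And>x. x \<in> space M \<Longrightarrow> f x + g x = - d" and "d > 0"
  shows "AE x in M. \<not> (unbounded_above (\<lambda>N. orbit_sum T f N x) \<and> unbounded_above (\<lambda>N. orbit_sum S (g \<circ> S) N x))"
proof -
  interpret T: measure_preserving_map M T by (rule T)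
  interpret S: measure_preserving_map M S by (rule S)
  have [measurable]: "f \<in> borel_measurable M" "g \<in> borel_measurable M" using f g by blast+
  have gS: "integrable M (g \<circ> S)" using S.integrable_comp_T[OF g] by (simp add: o_def)
  have [measurable]: "g \<circ> S \<in> borel_measurable M" using gS by blast
  let ?D = "{x \<in> space M. unbounded_above (\<lambda>N. orbit_sum T f N x) \<and> unbounded_above (\<lambda>N. orbit_sum S (g \<circ> S) N x)}"
  have D [measurable]: "?D \<in> sets M" by measurable
  have TD: "T x \<in> ?D \<longleftrightarrow> x \<in> ?D" if x: "x \<in> space M" for x
  proof -
    \<comment> \<open>Passing from \<open>x\<close> to \<open>T x\<close> puts the term
      \<open>g x\<close> in front of the backward sum, because \<open>S (T x) = x\<close>.\<close>
    have "unbounded_above (\<lambda>N. orbit_sum S (g \<circ> S) N (T x)) \<longleftrightarrow> unbounded_above (\<lambda>N. orbit_sum S (g \<circ> S) N x)"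
      by (rule unb_Suc_shift[of _ "g x"]) (simp add: orbit_sum_Suc ST x)
    then show ?thesis
      using x measurable_space[OF T.T_measurable x] by (simp add: T.unb_orbit_sum_T)
  qed
  have Sx: "S x \<in> space M" if "x \<in> space M" for x
    using measurable_space[OF S.T_measurable that] .
  have SD: "S x \<in> ?D \<longleftrightarrow> x \<in> ?D" if x: "x \<in> space M" for x
    using TD[OF Sx[OF x]] TS[OF x] by simp
  have 1: "0 \<le> (\<integral>x. indicator ?D x * f x \<partial>M)"
    using f D TD by (rule T.maximal_ergodic) (auto intro: unb_imp_pos)
  have "0 \<le> (\<integral>x. indicator ?D x * (g \<circ> S) x \<partial>M)"
    using gS D SD by (rule S.maximal_ergodic) (auto intro: unb_imp_pos)
  also have "\<dots> = (\<integral>x. (indicator ?D (S x) * g (S x)) \<partial>M)"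
    by (rule Bochner_Integration.integral_cong) (use SD in \<open>auto simp: indicator_def\<close>)
  also have "\<dots> = (\<integral>x. indicator ?D x * g x \<partial>M)"
    by (rule S.integral_comp_T) measurable
  finally have 2: "0 \<le> (\<integral>x. indicator ?D x * g x \<partial>M)" .
  \<comment> \<open>Both integrals over the invariant set \<open>?D\<close> are nonnegative, but
    \<open>f + g\<close> is \<open>- d\<close>, so their sum is \<open>- d\<close> times the
    probability of \<open>?D\<close>.\<close>
  have "0 \<le> (\<integral>x. indicator ?D x * f x \<partial>M) + (\<integral>x. indicator ?D x * g x \<partial>M)"
    using 1 2 by simp
  also have "\<dots> = (\<integral>x. indicator ?D x * f x + indicator ?D x * g x \<partial>M)"
    using integrable_mult_indicator[OF D f] integrable_mult_indicator[OF D g] by simp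
  also have "\<dots> = (\<integral>x. - d * indicator ?D x \<partial>M)"
    by (rule Bochner_Integration.integral_cong) (use fg in \<open>auto simp: indicator_def\<close>)
  also have "\<dots> = - d * T.prob ?D" using D by simp
  finally have "T.prob ?D \<le> 0"
    using \<open>d > 0\<close> by (simp add: mult_le_0_iff zero_le_mult_iff)
  then have "T.prob ?D = 0" by (simp add: measure_le_0_iff)
  then have "emeasure M ?D = 0" by (simp add: T.emeasure_eq_measure)
  then show ?thesis by (intro AE_I'[of ?D]) (auto simp: null_setsI)
qed

section \<open>Light-cone coordinates and the group\<close>

definition pc :: "'n::finite vec2 \<Rightarrow> real" where
  "pc v = v $ None + v $ Some None"

definition qc :: "'n::finite vec2 \<Rightarrow> real" where
  "qc v = v $ None - v $ Some None"

definition yc :: "'n::finite vec2 \<Rightarrow> real ^ 'n" where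
  "yc v = (\<chi> i. v $ Some (Some i))"

definition light_vec :: "real \<Rightarrow> real \<Rightarrow> real ^ 'n \<Rightarrow> 'n::finite vec2" where
  "light_vec p q y = (\<chi> j. case j of None \<Rightarrow> (p + q) / 2 | Some None \<Rightarrow> (p - q) / 2 | Some (Some i) \<Rightarrow> y $ i)"

lemma pc_light_vec [simp]: "pc (light_vec p q y) = p" and qc_light_vec [simp]: "qc (light_vec p q y) = q"
  and yc_light_vec [simp]: "yc (light_vec p q y) = y"
  by (simp_all add: pc_def qc_def yc_def light_vec_def vec_eq_iff field_simps)

lemma pc_linear: "linear pc" and qc_linear: "linear qc" and yc_linear: "linear yc"
  by (auto intro!: linearI simp: pc_def qc_def yc_def vec_eq_iff algebra_simps)

lemmas coord_linear [simp] =
  linear_add[OF pc_linear] linear_add[OF qc_linear] linear_add[OF yc_linear]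
  linear_scale[OF pc_linear] linear_scale[OF qc_linear] linear_scale[OF yc_linear]
  linear_0[OF pc_linear] linear_0[OF qc_linear] linear_0[OF yc_linear]

lemma light_coord_eq_iff: "u = v \<longleftrightarrow> pc u = pc v \<and> qc u = qc v \<and> yc u = yc v"
proof
  assume eq: "pc u = pc v \<and> qc u = qc v \<and> yc u = yc v"
  have "u $ j = v $ j" for j
  proof (cases j)
    case None
    then show ?thesis using eq by (simp add: pc_def qc_def)
  next
    case (Some k)
    show ?thesis
    proof (cases k)
      case None
      then show ?thesis using eq Some by (simp add: pc_def qc_def)
    next
      case (Some i)
      moreover have "yc u $ i = yc v $ i" using eq by simp
      ultimately show ?thesis using \<open>j = Some k\<close> by (simp add: yc_def)
    qed
  qed
  then show "u = v" by (simp add: vec_eq_iff)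
qed simp

lemma light_vec_coords [simp]: "light_vec (pc v) (qc v) (yc v) = v"
  by (simp add: light_coord_eq_iff)

lemma sum_UNIV_option:
  fixes f :: "'a::finite option \<Rightarrow> 'b::comm_monoid_add"
  shows "(\<Sum>i\<in>UNIV. f i) = f None + (\<Sum>i\<in>UNIV. f (Some i))"
  by (simp add: UNIV_option_conv sum.reindex)

lemma Qform_coords: "Qform v = yc v \<bullet> yc v - pc v * qc v"
  by (simp add: Qform_def sum_UNIV_option yc_def pc_def qc_def inner_vec_def power2_eq_square algebra_simps)

lemma norm_coords: "(norm v)\<^sup>2 = yc v \<bullet> yc v + ((pc v)\<^sup>2 + (qc v)\<^sup>2) / 2"
  unfolding power2_norm_eq_inner
  by (simp add: inner_vec_def sum_UNIV_option yc_def pc_def qc_def power2_eq_square field_simps)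

lemma norm_le_coords: "norm v \<le> norm (yc v) + \<bar>pc v\<bar> + \<bar>qc v\<bar>"
proof (rule power2_le_imp_le)
  have "(norm v)\<^sup>2 \<le> (norm (yc v))\<^sup>2 + \<bar>pc v\<bar>\<^sup>2 + \<bar>qc v\<bar>\<^sup>2"
    by (simp add: norm_coords power2_norm_eq_inner)
  also have "\<dots> \<le> (norm (yc v) + \<bar>pc v\<bar> + \<bar>qc v\<bar>)\<^sup>2"
    by (simp add: power2_sum algebra_simps del: power2_abs)
  finally show "(norm v)\<^sup>2 \<le> (norm (yc v) + \<bar>pc v\<bar> + \<bar>qc v\<bar>)\<^sup>2" .
qed auto

text \<open>On the cone p q = |y|^2 >= 0 and p + q = \<open>2 * v $ None\<close> >= 0, hence neither
  p nor q is negative.\<close>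

lemma light_cone_iff:
  "v \<in> light_cone \<longleftrightarrow> 0 \<le> pc v \<and> 0 \<le> qc v \<and> yc v \<bullet> yc v = pc v * qc v"
proof
  assume v: "v \<in> light_cone"
  then have eq: "yc v \<bullet> yc v = pc v * qc v" and "0 \<le> v $ None"
    by (auto simp: light_cone_def Qform_coords)
  have "0 \<le> pc v * qc v" using eq by (metis inner_ge_zero)
  moreover have "0 \<le> pc v + qc v" using \<open>0 \<le> v $ None\<close> by (simp add: pc_def qc_def)
  ultimately have "0 \<le> pc v \<and> 0 \<le> qc v"
    by (auto simp: zero_le_mult_iff)
  with eq show "0 \<le> pc v \<and> 0 \<le> qc v \<and> yc v \<bullet> yc v = pc v * qc v" by simp
next
  assume "0 \<le> pc v \<and> 0 \<le> qc v \<and> yc v \<bullet> yc v = pc v * qc v"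
  then show "v \<in> light_cone"
    by (auto simp: light_cone_def Qform_coords) (simp add: pc_def qc_def)
qed

lemma continuous_coords [continuous_intros]:
  "continuous_on S pc" "continuous_on S qc" "continuous_on S yc"
  unfolding pc_def[abs_def] qc_def[abs_def] yc_def[abs_def] by (intro continuous_intros)+

lemma borel_coords [measurable]:
  "pc \<in> borel_measurable borel" "qc \<in> borel_measurable borel" "yc \<in> borel_measurable borel"
  by (intro borel_measurable_continuous_onI continuous_intros)+

lemma light_cone_eq: "light_cone = {v. 0 \<le> pc v \<and> 0 \<le> qc v \<and> yc v \<bullet> yc v = pc v * qc v}"
  by (auto simp: light_cone_iff)

lemma closed_light_cone: "closed light_cone"
  unfolding light_cone_eq
  by (intro closed_Collect_conj closed_Collect_le closed_Collect_eq continuous_intros)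

lemma borel_light_cone [measurable]: "light_cone \<in> sets borel"
  by (intro borel_closed closed_light_cone)

lemma matrix_mult_linear: "linear f \<Longrightarrow> matrix f *v v = f v" for f :: "real ^ 'm \<Rightarrow> real ^ 'k"
  by (rule fun_cong[OF matrix_vector_mul(2)])

section \<open>Boosts and shears as elements of G\<close>

definition boost_fun :: "real \<Rightarrow> 'n::finite vec2 \<Rightarrow> 'n vec2" where
  "boost_fun t v = light_vec (exp t * pc v) (exp (- t) * qc v) (yc v)"

text \<open>The entry for q is the one that preserves |y|^2 - p q. These maps form an abelian
  unipotent group and fix the ray p = 0, y = 0 pointwise.\<close>

definition shear_fun :: "real ^ 'n \<Rightarrow> 'n::finite vec2 \<Rightarrow> 'n vec2" where
  "shear_fun b v = light_vec (pc v) (qc v + 2 * (b \<bullet> yc v) + (b \<bullet> b) * pc v) (yc v + pc v *\<^sub>R b)"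

definition boost :: "real \<Rightarrow> 'n::finite mat2" where "boost t = matrix (boost_fun t)"
definition shear :: "real ^ 'n \<Rightarrow> 'n::finite mat2" where "shear b = matrix (shear_fun b)"

lemma linear_boost_fun: "linear (boost_fun t)"
  by (rule linearI) (simp_all add: boost_fun_def light_coord_eq_iff algebra_simps)

lemma linear_shear_fun: "linear (shear_fun b)"
  by (rule linearI) (simp_all add: shear_fun_def light_coord_eq_iff algebra_simps inner_right_distrib)

lemma boost_mult: "boost t *v v = boost_fun t v"
  by (simp add: boost_def matrix_mult_linear[OF linear_boost_fun])

lemma shear_mult: "shear b *v v = shear_fun b v"
  by (simp add: shear_def matrix_mult_linear[OF linear_shear_fun])

lemma boost_coords [simp]:
  "pc (boost t *v v) = exp t * pc v" "qc (boost t *v v) = exp (- t) * qc v" "yc (boost t *v v) = yc v"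
  by (simp_all add: boost_mult boost_fun_def)

lemma shear_coords [simp]:
  "pc (shear b *v v) = pc v" "qc (shear b *v v) = qc v + 2 * (b \<bullet> yc v) + (b \<bullet> b) * pc v"
  "yc (shear b *v v) = yc v + pc v *\<^sub>R b"
  by (simp_all add: shear_mult shear_fun_def)

lemma mat_eqI: "(\<And>v. A *v v = B *v v) \<Longrightarrow> A = B"
  by (simp add: matrix_eq)

lemma boost_add: "boost s ** boost t = boost (s + t)"
  by (rule mat_eqI) (simp add: light_coord_eq_iff mult_exp_exp flip: matrix_vector_mul_assoc)

lemma shear_add: "shear a ** shear b = shear (a + b)"
  by (rule mat_eqI)
    (simp add: light_coord_eq_iff algebra_simps inner_commute flip: matrix_vector_mul_assoc)

lemma boost_0 [simp]: "boost 0 = mat 1"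
  by (rule mat_eqI) (simp add: light_coord_eq_iff)

lemma shear_0 [simp]: "shear 0 = mat 1"
  by (rule mat_eqI) (simp add: light_coord_eq_iff)

lemma Qform_boost: "Qform (boost t *v v) = Qform v"
  by (simp add: Qform_coords exp_minus)

lemma Qform_shear: "Qform (shear b *v v) = Qform v"
  by (simp add: Qform_coords algebra_simps inner_commute)

text \<open>Exchanging \<open>p\<close> and \<open>q\<close>, respectively changing the sign of \<open>y\<close>, conjugates the two one-parameter
  groups to their inverses, so all determinants are \<open>\<plusminus>1\<close>; being squares, they are \<open>1\<close>.\<close>

lemma det_conj_inverse:
  fixes A B S :: "'n::finite mat2"
  assumes "S ** S = mat 1" "A ** B = mat 1" "S ** A ** S = B"
  shows "det A * det A = 1"
proof -
  have "det S * det S = 1" "det A * det B = 1" "det S * det A * det S = det B"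
    using assms by (metis det_mul det_I)+
  then show ?thesis by (metis mult.assoc mult.commute mult.right_neutral)
qed

lemma det_boost: "det (boost t :: 'n::finite mat2) = 1"
proof -
  define S :: "'n mat2" where "S = matrix (\<lambda>v. light_vec (qc v) (pc v) (yc v))"
  have S: "S *v v = light_vec (qc v) (pc v) (yc v)" for v
    unfolding S_def by (subst matrix_mult_linear) (auto intro!: linearI simp: light_coord_eq_iff)
  have "det (boost (t / 2) :: 'n mat2) * det (boost (t / 2) :: 'n mat2) = 1"
  proof (rule det_conj_inverse[of S _ "boost (- (t / 2))"])
    show "S ** boost (t / 2) ** S = boost (- (t / 2))"
      by (rule mat_eqI) (simp add: S light_coord_eq_iff flip: matrix_vector_mul_assoc)
  qed (auto intro!: mat_eqI simp: S boost_add light_coord_eq_iff simp flip: matrix_vector_mul_assoc)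
  then show ?thesis
    using boost_add[of "t / 2" "t / 2"] by (metis det_mul field_sum_of_halves)
qed

lemma det_shear: "det (shear b :: 'n::finite mat2) = 1"
proof -
  define S :: "'n mat2" where "S = matrix (\<lambda>v. light_vec (pc v) (qc v) (- yc v))"
  have S: "S *v v = light_vec (pc v) (qc v) (- yc v)" for v
    unfolding S_def by (subst matrix_mult_linear) (auto intro!: linearI simp: light_coord_eq_iff)
  let ?b = "(1 / 2) *\<^sub>R b"
  have "det (shear ?b :: 'n mat2) * det (shear ?b :: 'n mat2) = 1"
  proof (rule det_conj_inverse[of S _ "shear (- ?b)"])
    show "S ** shear ?b ** S = shear (- ?b)"
      by (rule mat_eqI) (simp add: S light_coord_eq_iff flip: matrix_vector_mul_assoc)
  qed (auto intro!: mat_eqI simp: S shear_add light_coord_eq_iff simp flip: matrix_vector_mul_assoc)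
  moreover have "shear ?b ** shear ?b = shear b"
    by (simp add: shear_add flip: scaleR_left_distrib)
  ultimately show ?thesis by (metis det_mul)
qed

lemma boost_SO: "boost t \<in> SO_Q" and shear_SO: "shear b \<in> SO_Q"
  by (simp_all add: SO_Q_def det_boost det_shear Qform_boost Qform_shear)

lemma G_Q_pathI:
  fixes f :: "real \<Rightarrow> 'n::finite mat2"
  assumes "continuous_on {0..1} f" "f 0 = mat 1" "\<And>s. f s \<in> SO_Q"
  shows "f 1 \<in> G_Q"
proof -
  have "connected (f ` {0..1})"
    by (intro connected_continuous_image assms) simp
  moreover have "mat 1 \<in> f ` {0..1}" using assms(2) by (metis atLeastAtMost_iff imageI order_refl zero_le_one)
  ultimately have "f ` {0..1} \<subseteq> G_Q"
    unfolding G_Q_def using assms(3) by (intro connected_component_maximal) auto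
  then show ?thesis by auto
qed

lemma continuous_on_light_vec:
  assumes "continuous_on S f" "continuous_on S g" "continuous_on S h"
  shows "continuous_on S (\<lambda>x. light_vec (f x) (g x) (h x) :: 'b::finite vec2)"
  unfolding light_vec_def
proof (rule continuous_on_vec_lambda)
  fix j :: "'b option option"
  show "continuous_on S (\<lambda>x. case j of None \<Rightarrow> (f x + g x) / 2 | Some None \<Rightarrow> (f x - g x) / 2
      | Some (Some i) \<Rightarrow> h x $ i)"
  proof (cases j)
    case (Some k)
    then show ?thesis by (cases k) (auto intro!: continuous_intros assms)
  qed (auto intro!: continuous_intros assms)
qed

lemma boost_G: "boost t \<in> G_Q"
proof -
  have "continuous_on {0..1} (\<lambda>s. boost (s * t))"
    unfolding boost_def matrix_def boost_fun_def
    by (intro continuous_intros continuous_on_light_vec)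
  from G_Q_pathI[OF this] show ?thesis by (simp add: boost_SO)
qed

lemma shear_G: "shear b \<in> G_Q"
proof -
  have "continuous_on {0..1} (\<lambda>s. shear (s *\<^sub>R b))"
    unfolding shear_def matrix_def shear_fun_def
    by (intro continuous_intros continuous_on_light_vec)
  from G_Q_pathI[OF this] show ?thesis by (simp add: shear_SO)
qed

section \<open>The group G and its orbit of discrete sets\<close>

lemma G_Q_inverse:
  assumes "g \<in> G_Q"
  obtains h where "h \<in> G_Q" "g ** h = mat 1" "h ** g = mat 1"
proof -
  obtain B where B: "B \<in> SO_Q" "g ** B = mat 1" "B ** g = mat 1"
    using SO_Q_inverse assms G_Q_subset by blast
  have "B ** mat 1 \<in> G_Q" by (rule G_Q_left_mult[OF B(1) assms B(3) one_in_G_Q])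
  with B that show ?thesis by simp
qed

lemma G_Q_mult:
  assumes "g \<in> G_Q" "h \<in> G_Q"
  shows "g ** h \<in> G_Q"
proof -
  obtain k where k: "k \<in> G_Q" "g ** k = mat 1" using G_Q_inverse[OF assms(1)] by blast
  have "g \<in> SO_Q" using assms(1) G_Q_subset by blast
  from G_Q_left_mult[OF this k assms(2)] show ?thesis .
qed

lemma translate_X_space: "g \<in> G_Q \<Longrightarrow> L \<in> X_space \<Longrightarrow> translate g L \<in> X_space"
  by (auto simp: X_space_def simp flip: translate_mult intro: G_Q_mult)

lemma X_space_transitive:
  assumes "L \<in> X_space" "L' \<in> X_space"
  obtains h where "h \<in> G_Q" "translate h L = L'"
proof -
  obtain g g' where g: "g \<in> G_Q" "L = translate g Lambda0" "g' \<in> G_Q" "L' = translate g' Lambda0"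
    using assms by (auto simp: X_space_def)
  obtain k where k: "k \<in> G_Q" "k ** g = mat 1" using G_Q_inverse[OF g(1)] by blast
  have "translate (g' ** k) L = translate (g' ** (k ** g)) Lambda0"
    by (simp only: g(2) matrix_mul_assoc flip: translate_mult)
  also have "\<dots> = L'" by (simp add: k g(4))
  finally show ?thesis using that[of "g' ** k"] g k G_Q_mult by blast
qed

lemma finite_integer_points:
  fixes S :: "(real ^ 'm) set"
  assumes "bounded S" shows "finite {v \<in> S. \<forall>i. v $ i \<in> \<int>}"
proof -
  obtain B where B: "\<And>v. v \<in> S \<Longrightarrow> norm v \<le> B" using assms by (auto simp: bounded_iff)
  define K where "K = {k::real. k \<in> \<int> \<and> \<bar>k\<bar> \<le> B}"
  have "K \<subseteq> real_of_int ` {- \<lceil>B\<rceil>..\<lceil>B\<rceil>}"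
  proof
    fix k assume "k \<in> K"
    then obtain z where "k = real_of_int z" "\<bar>real_of_int z\<bar> \<le> B" by (auto simp: K_def elim: Ints_cases)
    moreover from this have "z \<in> {- \<lceil>B\<rceil>..\<lceil>B\<rceil>}" by simp linarith
    ultimately show "k \<in> real_of_int ` {- \<lceil>B\<rceil>..\<lceil>B\<rceil>}" by blast
  qed
  then have "finite K" by (rule finite_subset) simp
  then have "finite (vec_lambda ` (UNIV \<rightarrow>\<^sub>E K) :: (real ^ 'm) set)"
    by (intro finite_imageI finite_PiE) auto
  moreover have "{v \<in> S. \<forall>i. v $ i \<in> \<int>} \<subseteq> vec_lambda ` (UNIV \<rightarrow>\<^sub>E K)"
  proof
    fix v assume "v \<in> {v \<in> S. \<forall>i. v $ i \<in> \<int>}"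
    then have "\<bar>v $ i\<bar> \<le> B" "v $ i \<in> \<int>" for i
      using B[of v] component_le_norm_cart[of v i] by auto
    then have "vec_nth v \<in> UNIV \<rightarrow>\<^sub>E K"
      by (simp add: K_def PiE_UNIV_domain)
    then show "v \<in> vec_lambda ` (UNIV \<rightarrow>\<^sub>E K)" by (metis imageI vec_nth_inverse)
  qed
  ultimately show ?thesis by (rule finite_subset[rotated])
qed

text \<open>The inverse of \<open>g\<close> moves \<open>S\<close> to another bounded set and
  \<open>L\<close> into the integer points.\<close>

lemma finite_X_bounded:
  assumes "L \<in> X_space" "bounded S" shows "finite (S \<inter> L)"
proof -
  obtain g where g: "g \<in> G_Q" "L = translate g Lambda0" using assms(1) by (auto simp: X_space_def)
  obtain k where k: "k ** g = mat 1" using G_Q_inverse[OF g(1)] by blast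
  have "bounded ((*v) k ` S)"
    by (rule bounded_linear_image[OF assms(2)]) (simp add: linear_conv_bounded_linear[symmetric])
  then have "finite {v \<in> (*v) k ` S. \<forall>i. v $ i \<in> \<int>}" by (rule finite_integer_points)
  moreover have "S \<inter> L \<subseteq> (*v) g ` {v \<in> (*v) k ` S. \<forall>i. v $ i \<in> \<int>}"
  proof
    fix x assume "x \<in> S \<inter> L"
    then obtain v where v: "x = g *v v" "v \<in> Lambda0" "g *v v \<in> S" by (auto simp: g translate_def)
    then have "v = k *v (g *v v)" by (simp add: matrix_vector_mul_assoc k)
    with v show "x \<in> (*v) g ` {v \<in> (*v) k ` S. \<forall>i. v $ i \<in> \<int>}" by (auto simp: Lambda0_def)
  qed
  ultimately show ?thesis by (blast intro: finite_subset)
qed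

lemma zero_notin_X: "L \<in> X_space \<Longrightarrow> 0 \<notin> L"
proof
  assume "L \<in> X_space" and "0 \<in> L"
  then obtain g where g: "g \<in> G_Q" and "L = translate g Lambda0"
    unfolding X_space_def by blast
  with \<open>0 \<in> L\<close> obtain v where v: "v \<in> Lambda0" "0 = g *v v"
    by (auto simp: translate_def)
  obtain k where "k ** g = mat 1" using G_Q_inverse[OF g] by blast
  then have "v = k *v (g *v v)" by (simp add: matrix_vector_mul_assoc)
  then have "v = 0" using v by simp
  with v show False by (simp add: Lambda0_def)
qed

section \<open>Counting in shells\<close>

definition hits :: "'a set \<Rightarrow> 'a set \<Rightarrow> real" where
  "hits S L = real (card (S \<inter> L))"

text \<open>For \<open>b = 0\<close>, \<open>\<alpha> = 1\<close>, \<open>\<beta> = exp T\<close>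
  and \<open>s > 0\<close> this is \<open>F_set T s\<close>. On the cone, \<open>shell b\<close> is
  the preimage of \<open>shell 0\<close> under \<open>shear b\<close>, so \<open>b\<close> keeps
  track of a shear of the counted set.\<close>

definition shell :: "real ^ 'n \<Rightarrow> real \<Rightarrow> real \<Rightarrow> real \<Rightarrow> 'n::finite vec2 set" where
  "shell b s \<alpha> \<beta> = {v \<in> light_cone. \<alpha> \<le> pc v \<and> pc v < \<beta> \<and> norm (yc v + pc v *\<^sub>R b) < s}"

lemma shell_subset_cone: "shell b s \<alpha> \<beta> \<subseteq> light_cone"
  by (auto simp: shell_def)

lemma borel_shell [measurable]: "shell b s \<alpha> \<beta> \<in> sets borel"
proof -
  have "shell b s \<alpha> \<beta> = {v \<in> space borel. v \<in> light_cone \<and> \<alpha> \<le> pc v \<and> pc v < \<beta> \<and> norm (yc v + pc v *\<^sub>R b) < s}"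
    by (auto simp: shell_def)
  also have "\<dots> \<in> sets borel" by measurable
  finally show ?thesis .
qed

text \<open>On the cone q = |y|^2 / p, so bounding p from below bounds q.\<close>

lemma qc_le_of_cone:
  assumes "v \<in> light_cone" "0 < \<alpha>" "\<alpha> \<le> pc v" "norm (yc v) \<le> c"
  shows "qc v \<le> c\<^sup>2 / \<alpha>"
proof -
  have "\<alpha> * qc v \<le> pc v * qc v"
    using assms by (intro mult_right_mono) (auto simp: light_cone_iff)
  also have "\<dots> = (norm (yc v))\<^sup>2"
    using assms by (simp add: light_cone_iff power2_norm_eq_inner)
  also have "\<dots> \<le> c\<^sup>2" using assms by (intro power_mono) auto
  finally show ?thesis using \<open>0 < \<alpha>\<close> by (simp add: field_simps)
qed

lemma bounded_shell:
  assumes "0 < \<alpha>"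
  shows "bounded (shell b s \<alpha> \<beta>)"
proof -
  \<comment> \<open>This bounds |y|, since |y| <= |y + p b| + p |b|.\<close>
  define c where "c = s + \<beta> * norm b"
  have "norm v \<le> c + \<beta> + c\<^sup>2 / \<alpha>" if v: "v \<in> shell b s \<alpha> \<beta>" for v
  proof -
    have p: "0 < pc v" "\<alpha> \<le> pc v" "pc v < \<beta>" using v assms by (auto simp: shell_def)
    have "norm (yc v) \<le> norm (yc v + pc v *\<^sub>R b) + norm (pc v *\<^sub>R b)"
      by (metis add_diff_cancel norm_triangle_ineq4)
    also have "\<dots> \<le> s + \<beta> * norm b"
      using v p by (intro add_mono) (auto simp: shell_def mult_right_mono)
    finally have y: "norm (yc v) \<le> c" by (simp add: c_def)
    have "v \<in> light_cone" using v by (auto simp: shell_def)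
    then have "qc v \<le> c\<^sup>2 / \<alpha>" "0 \<le> qc v"
      using qc_le_of_cone[OF _ assms p(2) y] by (auto simp: light_cone_iff)
    then show ?thesis using norm_le_coords[of v] y p by linarith
  qed
  then show ?thesis by (auto simp: bounded_iff)
qed

lemma shell_boost:
  "{v. boost t *v v \<in> shell b s \<alpha> \<beta>} \<inter> light_cone = shell (exp t *\<^sub>R b) s (exp (- t) * \<alpha>) (exp (- t) * \<beta>)"
  by (auto simp: shell_def light_cone_iff exp_minus field_simps zero_le_mult_iff)

text \<open>The point is the sign of q. If p > 0, invariance of the form gives p q = |y|^2 >= 0 for
  the image; if p = 0, the cone equation forces y = 0 and q does not change.\<close>

lemma shear_cone:
  assumes "v \<in> light_cone"
  shows "shear a *v v \<in> light_cone"
proof -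
  have v: "0 \<le> pc v" "0 \<le> qc v" "yc v \<bullet> yc v = pc v * qc v"
    using assms by (auto simp: light_cone_iff)
  let ?w = "shear a *v v"
  have eq: "yc ?w \<bullet> yc ?w = pc v * qc ?w"
    using Qform_shear[of a v] v(3) by (simp only: Qform_coords shear_coords(1))
  have "0 \<le> qc ?w"
  proof (cases "pc v = 0")
    case True
    then show ?thesis using v by simp
  next
    case False
    have "0 \<le> pc v * qc ?w" by (metis eq inner_ge_zero)
    with False v(1) show ?thesis by (simp only: zero_le_mult_iff)  linarith
  qed
  then show ?thesis using eq v(1) by (simp only: light_cone_iff shear_coords(1))
qed

lemma shell_shear: "{v. shear a *v v \<in> shell b s \<alpha> \<beta>} \<inter> light_cone = shell (a + b) s \<alpha> \<beta>"
  by (auto simp: shell_def shear_cone algebra_simps)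

lemma shell_mono: "s \<le> s' \<Longrightarrow> \<alpha>' \<le> \<alpha> \<Longrightarrow> \<beta> \<le> \<beta>' \<Longrightarrow> shell b s \<alpha> \<beta> \<subseteq> shell b s' \<alpha>' \<beta>'"
  by (auto simp: shell_def)

lemma hits_mono:
  assumes "S \<subseteq> S'" "finite (S' \<inter> L)" shows "hits S L \<le> hits S' L"
  unfolding hits_def using assms by (intro of_nat_mono card_mono) auto

lemma hits_split:
  assumes L: "L \<in> X_space" and "0 < \<alpha>" "\<alpha> \<le> \<beta>" "\<beta> \<le> \<gamma>"
  shows "hits (shell b s \<alpha> \<gamma>) L = hits (shell b s \<alpha> \<beta>) L + hits (shell b s \<beta> \<gamma>) L"
proof -
  have "shell b s \<alpha> \<gamma> \<inter> L = (shell b s \<alpha> \<beta> \<inter> L) \<union> (shell b s \<beta> \<gamma> \<inter> L)"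
    using assms by (auto simp: shell_def)
  moreover have "finite (shell b s \<alpha> \<beta> \<inter> L)" "finite (shell b s \<beta> \<gamma> \<inter> L)"
    using assms by (auto intro!: finite_X_bounded bounded_shell)
  moreover have "(shell b s \<alpha> \<beta> \<inter> L) \<inter> (shell b s \<beta> \<gamma> \<inter> L) = {}"
    by (auto simp: shell_def)
  ultimately show ?thesis by (simp add: hits_def card_Un_disjoint)
qed

lemma inj_G_Q: "g \<in> G_Q \<Longrightarrow> inj ((*v) g)"
proof -
  assume "g \<in> G_Q"
  then obtain h where "h ** g = mat 1" using G_Q_inverse by blast
  then have "h *v (g *v v) = v" for v by (simp add: matrix_vector_mul_assoc)
  then show ?thesis by (metis injI)
qed

lemma hits_translate:
  assumes "g \<in> G_Q"
  shows "hits S (translate g L) = hits {v. g *v v \<in> S} L"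
proof -
  have "S \<inter> translate g L = (*v) g ` ({v. g *v v \<in> S} \<inter> L)" by (auto simp: translate_def)
  then show ?thesis
    using inj_G_Q[OF assms] by (simp add: hits_def card_image inj_on_subset[OF _ subset_UNIV])
qed

lemma hits_cone: "L \<subseteq> light_cone \<Longrightarrow> hits S L = hits (S \<inter> light_cone) L"
  by (simp add: hits_def Int_assoc inf_absorb2)

section \<open>Invariant measures and the mean value formula for counts\<close>

lemma emeasure_bounded_cone:
  assumes "invariant_radon_cone lam" and "bounded S" "S \<in> sets lam"
  shows "emeasure lam S < \<infinity>"
proof -
  have "S \<subseteq> light_cone"
    using assms(1,3) by (auto simp: invariant_radon_cone_def sets_restrict_space)
  obtain r where "\<And>v. v \<in> S \<Longrightarrow> norm v \<le> r" using \<open>bounded S\<close> by (auto simp: bounded_iff)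
  then have "S \<subseteq> cball 0 r" by auto
  have "emeasure lam (light_cone \<inter> cball 0 r) < \<infinity>"
    using assms(1) closed_Int_compact[OF closed_light_cone compact_cball]
    by (auto simp: invariant_radon_cone_def)
  moreover have "light_cone \<inter> cball 0 r \<in> sets lam"
    using assms(1) by (auto simp: invariant_radon_cone_def sets_restrict_space)
  ultimately show ?thesis
    using emeasure_mono[of S "light_cone \<inter> cball 0 r" lam] \<open>S \<subseteq> light_cone\<close> \<open>S \<subseteq> cball 0 r\<close>
    by (auto intro: le_less_trans)
qed

locale siegel_space =
  fixes mu :: "'n::finite vec2 set measure" and lam :: "'n vec2 measure"
  assumes mu: "invariant_prob_X mu" and lam: "invariant_radon_cone lam"
    and siegel: "siegel_normalized mu lam"
begin

sublocale prob_space mu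
  using mu by (simp add: invariant_prob_X_def)

lemma space_mu: "space mu = X_space"
proof -
  have "space mu = space X_borel"
    using mu by (intro sets_eq_imp_space_eq) (simp add: invariant_prob_X_def)
  also have "\<dots> = X_space"
    unfolding X_borel_def by (rule space_measure_of) (auto dest!: openin_subset simp: topspace_X_top)
  finally show ?thesis .
qed

lemma sets_lam: "sets lam = sets (restrict_space borel light_cone)"
  using lam by (simp add: invariant_radon_cone_def)

lemma space_lam: "space lam = light_cone"
  using sets_eq_imp_space_eq[OF sets_lam] by (simp add: space_restrict_space)

lemma sets_lamI: "S \<in> sets borel \<Longrightarrow> S \<subseteq> light_cone \<Longrightarrow> S \<in> sets lam"
  by (auto simp: sets_lam sets_restrict_space)

lemma shell_sets_lam: "shell b s \<alpha> \<beta> \<in> sets lam"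
  by (intro sets_lamI shell_subset_cone) measurable

text \<open>That G does not exchange the two halves of the cone is read off from the measure:
  invariance makes the image of the cone a measurable set of \<open>lam\<close>, hence a subset of
  its space.\<close>

lemma G_cone: "(g :: 'n mat2) \<in> G_Q \<Longrightarrow> v \<in> light_cone \<Longrightarrow> g *v v \<in> light_cone"
proof -
  assume g: "g \<in> G_Q" and v: "v \<in> light_cone"
  have "light_cone \<in> sets lam" using sets.top[of lam] by (simp add: space_lam)
  with g have "(*v) g ` light_cone \<in> sets lam"
    using lam unfolding invariant_radon_cone_def invariant_measure_def by blast
  then show ?thesis using v sets.sets_into_space space_lam by blast
qed

lemma X_cone: "(L :: 'n vec2 set) \<in> X_space \<Longrightarrow> L \<subseteq> light_cone"
  using G_cone by (fastforce simp: X_space_def translate_def Lambda0_def)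

text \<open>Invariance is stated for images; the preimage under \<open>g\<close> is the image under
  its inverse, which also lies in G.\<close>

lemma measure_preserving_translate:
  assumes g: "g \<in> G_Q"
  shows "measure_preserving_map mu (translate g)"
proof -
  obtain h where h: "h \<in> G_Q" "g ** h = mat 1" "h ** g = mat 1"
    using G_Q_inverse[OF g] by blast
  have gh: "translate g (translate h L) = L" "translate h (translate g L) = L" for L :: "'n vec2 set"
    by (simp_all add: h flip: translate_mult)
  have vimage: "translate g -` A \<inter> space mu = translate h ` A" if "A \<in> sets mu" for A
  proof -
    have "A \<subseteq> X_space" using sets.sets_into_space[OF that] by (simp add: space_mu)
    show ?thesis
    proof (intro set_eqI iffI)
      fix L assume "L \<in> translate g -` A \<inter> space mu"
      then show "L \<in> translate h ` A" using gh(2)[of L] by (metis IntD1 imageI vimageD)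
    next
      fix L assume "L \<in> translate h ` A"
      then show "L \<in> translate g -` A \<inter> space mu"
        using \<open>A \<subseteq> X_space\<close> translate_X_space[OF h(1)] by (auto simp: gh space_mu)
    qed
  qed
  have inv: "translate h ` A \<in> sets mu" "emeasure mu (translate h ` A) = emeasure mu A"
    if "A \<in> sets mu" for A
    using mu h(1) that unfolding invariant_prob_X_def invariant_measure_def by blast+
  have meas: "translate g \<in> mu \<rightarrow>\<^sub>M mu"
    using translate_X_space[OF g] by (intro measurableI) (auto simp: space_mu vimage[unfolded space_mu] inv)
  show ?thesis
  proof
    show "distr mu mu (translate g) = mu"
      by (rule measure_eqI) (simp_all add: emeasure_distr[OF meas] vimage inv)
  qed (rule meas)
qed

lemma AE_translate:
  assumes g: "g \<in> G_Q" and "AE L in mu. P L"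
  shows "AE L in mu. P (translate g L)"
proof -
  interpret measure_preserving_map mu "translate g" by (rule measure_preserving_translate[OF g])
  show ?thesis
    by (rule AE_distrD[OF T_measurable]) (simp only: distr_T assms(2))
qed

lemma siegel_transform_indicator:
  fixes L :: "'n vec2 set"
  assumes L: "L \<in> X_space" and "bounded S"
  shows "siegel_transform (indicator S) L = hits S L"
proof -
  have "siegel_transform (indicator S) L = infsum (\<lambda>_. 1) (S \<inter> L)"
    unfolding siegel_transform_def
    by (rule infsum_cong_neutral) (use zero_notin_X[OF L] in auto)
  then show ?thesis using finite_X_bounded[OF assms] by (simp add: hits_def)
qed

text \<open>The mean value formula for an indicator function: boundedness gives finite mass on the
  cone and finite counts on the orbit.\<close>

lemma
  assumes S: "S \<in> sets lam" "bounded S"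
  shows integrable_hits: "integrable mu (hits S)" and integral_hits: "(\<integral>L. hits S L \<partial>mu) = measure lam S"
proof -
  have "integrable lam (indicator S :: _ \<Rightarrow> real)"
    using S emeasure_bounded_cone[OF lam S(2,1)] by (simp add: integrable_indicator_iff)
  then have *: "integrable mu (siegel_transform (indicator S))"
    "(\<integral>L. siegel_transform (indicator S) L \<partial>mu) = (\<integral>v. indicator S v \<partial>lam)"
    using siegel by (auto simp: siegel_normalized_def)
  have eq: "siegel_transform (indicator S) L = hits S L" if "L \<in> space mu" for L
    using that S by (intro siegel_transform_indicator) (auto simp: space_mu)
  show "integrable mu (hits S)"
    using *(1) eq by (subst Bochner_Integration.integrable_cong[OF refl eq[symmetric]]) auto
  have "(\<integral>L. hits S L \<partial>mu) = (\<integral>L. siegel_transform (indicator S) L \<partial>mu)"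
    by (rule Bochner_Integration.integral_cong) (simp_all add: eq)
  also have "\<dots> = measure lam S"
    using *(2) S(1) sets.sets_into_space[OF S(1)] by (simp add: Int_absorb2)
  finally show "(\<integral>L. hits S L \<partial>mu) = measure lam S" .
qed

lemma measurable_hits_shell [measurable]:
  "0 < \<alpha> \<Longrightarrow> hits (shell b s \<alpha> \<beta>) \<in> borel_measurable mu"
  using integrable_hits[OF shell_sets_lam bounded_shell] by blast

lemma hits_boost:
  fixes L :: "'n vec2 set"
  assumes "L \<in> X_space"
  shows "hits (shell b s \<alpha> \<beta>) (translate (boost t) L) = hits (shell (exp t *\<^sub>R b) s (exp (- t) * \<alpha>) (exp (- t) * \<beta>)) L"
  unfolding hits_translate[OF boost_G] by (subst hits_cone[OF X_cone[OF assms]]) (simp only: shell_boost)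

lemma hits_shear:
  fixes L :: "'n vec2 set"
  assumes "L \<in> X_space"
  shows "hits (shell b s \<alpha> \<beta>) (translate (shear a) L) = hits (shell (a + b) s \<alpha> \<beta>) L"
  unfolding hits_translate[OF shear_G] by (subst hits_cone[OF X_cone[OF assms]]) (simp only: shell_shear)

end

section \<open>Forward and backward densities\<close>

lemma shell_empty: "\<beta> \<le> \<alpha> \<Longrightarrow> shell b s \<alpha> \<beta> = {}"
  by (auto simp: shell_def)

text \<open>With \<open>b = 0\<close>, \<open>fwd\<close> and \<open>bwd\<close> are orbit sums of
  one count in the two time directions; a general \<open>b\<close> gives their values at
  \<open>translate (shear b) L\<close>.\<close>

definition fwd :: "real ^ 'n \<Rightarrow> real \<Rightarrow> nat \<Rightarrow> 'n::finite vec2 set \<Rightarrow> real" where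
  "fwd b s N L = hits (shell b s 1 (exp (real N))) L"

definition bwd :: "real ^ 'n \<Rightarrow> real \<Rightarrow> nat \<Rightarrow> 'n::finite vec2 set \<Rightarrow> real" where
  "bwd b s N L = hits (shell b s (exp (- real N)) 1) L"

text \<open>The parameters are rational so that the exceptional set is a countable union of null sets.\<close>

definition balanced :: "real ^ 'n \<Rightarrow> 'n::finite vec2 set \<Rightarrow> bool" where
  "balanced b L \<longleftrightarrow> (\<forall>s \<alpha> \<beta> :: rat. \<alpha> < \<beta> \<longrightarrow>
     \<not> (unbounded_above (\<lambda>N. fwd b (of_rat s) N L - of_rat \<beta> * real N) \<and>
        unbounded_above (\<lambda>N. of_rat \<alpha> * real N - bwd b (of_rat s) N L)) \<and>
     \<not> (unbounded_above (\<lambda>N. bwd b (of_rat s) N L - of_rat \<beta> * real N) \<and>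
        unbounded_above (\<lambda>N. of_rat \<alpha> * real N - fwd b (of_rat s) N L)))"

lemma orbit_sum_affine:
  "orbit_sum T (\<lambda>x. c * f x + d) N x = c * orbit_sum T f N x + d * real N"
  by (simp add: orbit_sum_def sum.distrib sum_distrib_left)

context siegel_space
begin

text \<open>Boosting by -1 brings the layers e <= p < e^(N+1) to 1 <= p < e^N with the same bound on
  y, so each step of the orbit counts the next layer.\<close>

lemma orbit_sum_fwd:
  fixes L :: "'n vec2 set"
  assumes "L \<in> X_space"
  shows "orbit_sum (translate (boost (- 1))) (hits (shell 0 s 1 (exp 1))) N L = fwd 0 s N L"
  using assms
proof (induction N arbitrary: L)
  case 0
  then show ?case by (simp add: fwd_def hits_def shell_empty)
next
  case (Suc N)
  have "fwd 0 s N (translate (boost (- 1)) L) = hits (shell 0 s (exp 1) (exp (real (Suc N)))) L"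
    by (simp add: fwd_def hits_boost Suc.prems exp_add[symmetric] add.commute)
  moreover have "fwd 0 s (Suc N) L = hits (shell 0 s 1 (exp 1)) L + hits (shell 0 s (exp 1) (exp (real (Suc N)))) L"
    unfolding fwd_def using Suc.prems by (rule hits_split) auto
  ultimately show ?case
    using Suc.IH[OF translate_X_space[OF boost_G Suc.prems]] by (simp add: orbit_sum_Suc)
qed

text \<open>The extra \<open>translate (boost 1)\<close> in the summand makes e^(-1) <= p < 1 the
  first layer, so the forward and backward sums share no layer.\<close>

lemma orbit_sum_bwd:
  fixes L :: "'n vec2 set"
  assumes "L \<in> X_space"
  shows "orbit_sum (translate (boost 1)) (hits (shell 0 s 1 (exp 1)) \<circ> translate (boost 1)) N L = bwd 0 s N L"
  using assms
proof (induction N arbitrary: L)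
  case 0
  then show ?case by (simp add: bwd_def hits_def shell_empty)
next
  case (Suc N)
  have "bwd 0 s N (translate (boost 1) L) = hits (shell 0 s (exp (- real (Suc N))) (exp (- 1))) L"
    by (simp add: bwd_def hits_boost Suc.prems exp_add[symmetric])
  moreover have "hits (shell 0 s 1 (exp 1)) (translate (boost 1) L) = hits (shell 0 s (exp (- 1)) 1) L"
    by (simp add: hits_boost Suc.prems exp_add[symmetric])
  moreover have "bwd 0 s (Suc N) L = hits (shell 0 s (exp (- real (Suc N))) (exp (- 1))) L + hits (shell 0 s (exp (- 1)) 1) L"
    unfolding bwd_def using Suc.prems by (rule hits_split) auto
  ultimately show ?case
    using Suc.IH[OF translate_X_space[OF boost_G Suc.prems]] by (simp add: orbit_sum_Suc)
qed

lemma integrable_affine_hits: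
  "integrable mu (\<lambda>L. c * hits (shell 0 s 1 (exp 1)) L + d)"
  using integrable_hits[OF shell_sets_lam bounded_shell, of 1 0 s "exp 1"] by auto

text \<open>\<open>forward_backward_unb\<close> with F - \<beta> in one direction and \<alpha> - F
  in the other, where F counts in the shell 1 <= p < e; these add up to the constant -(\<beta> -
  \<alpha>). The second claim exchanges the directions.\<close>

lemma AE_fwd_bwd:
  assumes "\<alpha> < \<beta>"
  shows "AE L in mu. \<not> (unbounded_above (\<lambda>N. fwd 0 s N L - \<beta> * real N) \<and> unbounded_above (\<lambda>N. \<alpha> * real N - bwd 0 s N L))"
    and "AE L in mu. \<not> (unbounded_above (\<lambda>N. bwd 0 s N L - \<beta> * real N) \<and> unbounded_above (\<lambda>N. \<alpha> * real N - fwd 0 s N L))"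
proof -
  let ?T = "translate (boost (- 1)) :: 'n vec2 set \<Rightarrow> _" and ?S = "translate (boost 1) :: 'n vec2 set \<Rightarrow> _"
  let ?F = "hits (shell 0 s 1 (exp 1)) :: 'n vec2 set \<Rightarrow> real"
  have T: "measure_preserving_map mu ?T" and S: "measure_preserving_map mu ?S"
    by (intro measure_preserving_translate boost_G)+
  have ST: "?S (?T L) = L" and TS: "?T (?S L) = L" for L
    by (simp_all add: boost_add flip: translate_mult)
  have comp: "(\<lambda>L. c * ?F L + d) \<circ> ?S = (\<lambda>L. c * (?F \<circ> ?S) L + d)" for c d
    by auto
  note * = forward_backward_unb[OF T S ST TS integrable_affine_hits integrable_affine_hits]
  have "AE L in mu. \<not> (unbounded_above (\<lambda>N. orbit_sum ?T (\<lambda>L. 1 * ?F L + (- \<beta>)) N L) \<and>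
      unbounded_above (\<lambda>N. orbit_sum ?S ((\<lambda>L. (- 1) * ?F L + \<alpha>) \<circ> ?S) N L))"
    by (rule *[where d = "\<beta> - \<alpha>"]) (use assms in auto)
  then show "AE L in mu. \<not> (unbounded_above (\<lambda>N. fwd 0 s N L - \<beta> * real N) \<and> unbounded_above (\<lambda>N. \<alpha> * real N - bwd 0 s N L))"
    unfolding comp orbit_sum_affine
    by (rule AE_mp[OF _ AE_I2]) (auto simp: space_mu orbit_sum_fwd orbit_sum_bwd[unfolded o_def] o_def algebra_simps)
  have "AE L in mu. \<not> (unbounded_above (\<lambda>N. orbit_sum ?T (\<lambda>L. (- 1) * ?F L + \<alpha>) N L) \<and>
      unbounded_above (\<lambda>N. orbit_sum ?S ((\<lambda>L. 1 * ?F L + (- \<beta>)) \<circ> ?S) N L))"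
    by (rule *[where d = "\<beta> - \<alpha>"]) (use assms in auto)
  then show "AE L in mu. \<not> (unbounded_above (\<lambda>N. bwd 0 s N L - \<beta> * real N) \<and> unbounded_above (\<lambda>N. \<alpha> * real N - fwd 0 s N L))"
    unfolding comp orbit_sum_affine
    by (rule AE_mp[OF _ AE_I2]) (auto simp: space_mu orbit_sum_fwd orbit_sum_bwd[unfolded o_def] o_def algebra_simps)
qed

lemma AE_balanced: "AE L in mu. balanced 0 L"
proof -
  have "AE L in mu. \<not> (unbounded_above (\<lambda>N. fwd 0 (of_rat s) N L - of_rat \<beta> * real N) \<and>
        unbounded_above (\<lambda>N. of_rat \<alpha> * real N - bwd 0 (of_rat s) N L)) \<and>
     \<not> (unbounded_above (\<lambda>N. bwd 0 (of_rat s) N L - of_rat \<beta> * real N) \<and>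
        unbounded_above (\<lambda>N. of_rat \<alpha> * real N - fwd 0 (of_rat s) N L))" if "\<alpha> < \<beta>" for s \<alpha> \<beta> :: rat
    using AE_fwd_bwd[of "of_rat \<alpha>" "of_rat \<beta>" "of_rat s"] that by (auto simp: of_rat_less)
  then show ?thesis
    unfolding balanced_def AE_all_countable by auto
qed

lemma balanced_shear:
  fixes L :: "'n vec2 set"
  assumes "L \<in> X_space"
  shows "balanced b (translate (shear a) L) \<longleftrightarrow> balanced (a + b) L"
  using assms by (simp add: balanced_def fwd_def bwd_def hits_shear)

text \<open>A superlevel set is a countable union of rectangles: the parameter is moved to a nearby
  \<open>d\<close> of a countable dense set, and the radius shrinks by a bound for the resulting
  displacement.\<close>

lemma measurable_hits_shell_pair:
  assumes "0 < \<alpha>" "0 < \<beta>"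
  shows "(\<lambda>w. hits (shell (fst w) s \<alpha> \<beta>) (snd w)) \<in> borel_measurable (lborel \<Otimes>\<^sub>M mu)"
proof -
  obtain D :: "(real ^ 'n) set" where D: "countable D" "\<And>X. open X \<Longrightarrow> X \<noteq> {} \<Longrightarrow> \<exists>d\<in>D. d \<in> X"
    by (rule countable_dense_setE) auto
  define r where "r k = inverse (real (Suc k))" for k
  have fin: "finite (shell b s \<alpha> \<beta> \<inter> L)" if "L \<in> X_space" for L :: "'n vec2 set" and b s
    using finite_X_bounded[OF that bounded_shell[OF assms(1)]] .
  have eq: "{w \<in> space (lborel \<Otimes>\<^sub>M mu). a \<le> hits (shell (fst w) s \<alpha> \<beta>) (snd w)} =
    (\<Union>d\<in>D. \<Union>k. ball d (r k) \<times> {L \<in> space mu. a \<le> hits (shell d (s - r k * \<beta>) \<alpha> \<beta>) L})" (is "?l = ?r") for a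
  proof (intro set_eqI iffI)
    fix w assume "w \<in> ?r"
    then obtain d k where w: "fst w \<in> ball d (r k)" "snd w \<in> X_space"
        "a \<le> hits (shell d (s - r k * \<beta>) \<alpha> \<beta>) (snd w)"
      by (auto simp: space_mu)
    have "shell d (s - r k * \<beta>) \<alpha> \<beta> \<subseteq> shell (fst w) s \<alpha> \<beta>"
    proof
      fix v assume v: "v \<in> shell d (s - r k * \<beta>) \<alpha> \<beta>"
      have "norm (yc v + pc v *\<^sub>R fst w) \<le> norm (yc v + pc v *\<^sub>R d) + norm (pc v *\<^sub>R (fst w - d))"
        using norm_triangle_ineq[of "yc v + pc v *\<^sub>R d" "pc v *\<^sub>R (fst w - d)"]
        by (simp add: algebra_simps)
      also have "norm (pc v *\<^sub>R (fst w - d)) \<le> \<beta> * r k"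
        using v w(1) assms by (auto simp: shell_def dist_norm norm_minus_commute intro!: mult_mono)
      finally show "v \<in> shell (fst w) s \<alpha> \<beta>" using v by (auto simp: shell_def algebra_simps)
    qed
    then have "hits (shell d (s - r k * \<beta>) \<alpha> \<beta>) (snd w) \<le> hits (shell (fst w) s \<alpha> \<beta>) (snd w)"
      by (rule hits_mono) (rule fin[OF w(2)])
    then show "w \<in> ?l" using w by (cases w) (auto simp: space_pair_measure space_mu)
  next
    fix w assume "w \<in> ?l"
    then have w: "snd w \<in> X_space" "a \<le> hits (shell (fst w) s \<alpha> \<beta>) (snd w)"
      by (auto simp: space_pair_measure space_mu)
    let ?P = "shell (fst w) s \<alpha> \<beta> \<inter> snd w"
    \<comment> \<open>The finitely many counted vectors satisfy the strict bound with a common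
      margin; the inserted 1 covers the case of no vectors.\<close>
    obtain \<delta> where \<delta>: "\<delta> > 0" "\<And>v. v \<in> ?P \<Longrightarrow> \<delta> \<le> s - norm (yc v + pc v *\<^sub>R fst w)"
    proof
      let ?A = "insert 1 ((\<lambda>v. s - norm (yc v + pc v *\<^sub>R fst w)) ` ?P)"
      have "finite ?A" using fin[OF w(1)] by simp
      then show "Min ?A > 0" "\<And>v. v \<in> ?P \<Longrightarrow> Min ?A \<le> s - norm (yc v + pc v *\<^sub>R fst w)"
        by (auto simp: shell_def)
    qed
    \<comment> \<open>The factor 2 pays for two losses of at most \<open>\<beta> * r k\<close>:
      moving the parameter and shrinking the radius.\<close>
    obtain k where k: "r k < \<delta> / (2 * \<beta>)"
      using reals_Archimedean[of "\<delta> / (2 * \<beta>)"] \<delta>(1) assms by (auto simp: r_def)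
    have "0 < r k" by (simp add: r_def)
    then obtain d where d: "d \<in> D" "d \<in> ball (fst w) (r k)"
      using D(2)[of "ball (fst w) (r k)"] by auto
    have "?P \<subseteq> shell d (s - r k * \<beta>) \<alpha> \<beta> \<inter> snd w"
    proof
      fix v assume v: "v \<in> ?P"
      have "norm (yc v + pc v *\<^sub>R d) \<le> norm (yc v + pc v *\<^sub>R fst w) + norm (pc v *\<^sub>R (d - fst w))"
        using norm_triangle_ineq[of "yc v + pc v *\<^sub>R fst w" "pc v *\<^sub>R (d - fst w)"]
        by (simp add: algebra_simps)
      also have "norm (pc v *\<^sub>R (d - fst w)) \<le> \<beta> * r k"
        using v d(2) assms by (auto simp: shell_def dist_norm norm_minus_commute intro!: mult_mono)
      also have "norm (yc v + pc v *\<^sub>R fst w) \<le> s - \<delta>" using \<delta>(2)[OF v] by simp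
      finally have "norm (yc v + pc v *\<^sub>R d) < s - r k * \<beta>"
        using k assms by (simp add: field_simps)
      then show "v \<in> shell d (s - r k * \<beta>) \<alpha> \<beta> \<inter> snd w" using v by (auto simp: shell_def)
    qed
    then have "hits (shell (fst w) s \<alpha> \<beta>) (snd w) \<le> hits (shell d (s - r k * \<beta>) \<alpha> \<beta>) (snd w)"
      unfolding hits_def using fin[OF w(1)] by (intro of_nat_mono card_mono) auto
    with w d show "w \<in> ?r" by (cases w) (auto simp: space_mu dist_commute intro!: bexI[of _ d] exI[of _ k])
  qed
  have "ball d (r k) \<times> {L \<in> space mu. a \<le> hits (shell d (s - r k * \<beta>) \<alpha> \<beta>) L} \<in> sets (lborel \<Otimes>\<^sub>M mu)"
    for a d k
    using assms by (intro pair_measureI) measurable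
  then show ?thesis
    unfolding borel_measurable_iff_ge eq using D(1)
    by (intro allI sets.countable_UN'' sets.countable_UN) auto
qed

lemma measurable_balanced: "{w \<in> space (lborel \<Otimes>\<^sub>M mu). balanced (fst w) (snd w)} \<in> sets (lborel \<Otimes>\<^sub>M mu)"
proof -
  have [measurable]: "(\<lambda>w. fwd (fst w) s N (snd w)) \<in> borel_measurable (lborel \<Otimes>\<^sub>M mu)"
    "(\<lambda>w. bwd (fst w) s N (snd w)) \<in> borel_measurable (lborel \<Otimes>\<^sub>M mu)" for s N
    unfolding fwd_def bwd_def by (intro measurable_hits_shell_pair; simp)+
  show ?thesis
    unfolding balanced_def unbounded_above_def by measurable
qed

text \<open>\<open>AE_balanced\<close> transported by \<open>shear b\<close> gives each fixed
  \<open>b\<close> its own null set of exceptional L; Fubini's theorem exchanges the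
  quantifiers.\<close>

lemma AE_AE_balanced: "AE L in mu. AE b in lborel. balanced b L"
proof -
  interpret pair_sigma_finite lborel mu ..
  have "AE L in mu. balanced b L" for b
    using AE_translate[OF shear_G[of b] AE_balanced]
    by (rule AE_mp[OF _ AE_I2]) (simp add: balanced_shear space_mu)
  then have "AE b in lborel. AE L in mu. balanced b L" by simp
  then show ?thesis by (subst (asm) AE_commute[OF measurable_balanced])
qed

end

section \<open>Invariance of the densities\<close>

lemma unb_slope_mono:
  assumes "unbounded_above (\<lambda>N. s N - \<beta> * real N)" "\<beta>' \<le> \<beta>"
  shows "unbounded_above (\<lambda>N. s N - \<beta>' * real N)"
  by (rule unb_shift_le[OF assms(1), of 0 _ 0]) (use assms(2) in \<open>simp add: mult_right_mono\<close>)

lemma unb_slope_mono':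
  assumes "unbounded_above (\<lambda>N. \<alpha> * real N - s N)" "\<alpha> \<le> \<alpha>'"
  shows "unbounded_above (\<lambda>N. \<alpha>' * real N - s N)"
  by (rule unb_shift_le[OF assms(1), of 0 _ 0]) (use assms(2) in \<open>simp add: mult_right_mono\<close>)

text \<open>If s(N) >= \<alpha> N - C for all N, every smaller slope leaves a linear gain.\<close>

lemma unb_of_not_unb:
  assumes "\<not> unbounded_above (\<lambda>N. \<alpha> * real N - s N)" "\<alpha>' < \<alpha>"
  shows "unbounded_above (\<lambda>N. s N - \<alpha>' * real N)"
  unfolding unbounded_above_def
proof
  fix K :: nat
  obtain C :: nat where C: "\<And>N. \<alpha> * real N - s N \<le> real C"
    using assms(1) by (auto simp: unbounded_above_def not_less)
  obtain N :: nat where "(real K + real C) / (\<alpha> - \<alpha>') < real N" using reals_Archimedean2 by blast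
  then have "real K + real C < \<alpha> * real N - \<alpha>' * real N"
    using assms(2) by (simp add: field_simps)
  then have "real K < s N - \<alpha>' * real N" using C[of N] by linarith
  then show "\<exists>N. real K < s N - \<alpha>' * real N" ..
qed

lemma hits_le_add:
  assumes "S \<inter> L \<subseteq> S1 \<union> S2" "finite (S1 \<inter> L)" "finite (S2 \<inter> L)"
  shows "hits S L \<le> hits S1 L + hits S2 L"
proof -
  have "card (S \<inter> L) \<le> card ((S1 \<inter> L) \<union> (S2 \<inter> L))" using assms by (intro card_mono) auto
  also have "\<dots> \<le> card (S1 \<inter> L) + card (S2 \<inter> L)" by (rule card_Un_le)
  finally show ?thesis by (simp add: hits_def)
qed

lemma finite_shell_X: "L \<in> X_space \<Longrightarrow> 0 < \<alpha> \<Longrightarrow> finite (shell b s \<alpha> \<beta> \<inter> L)"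
  by (intro finite_X_bounded bounded_shell)

lemma fwd_mono: "L \<in> X_space \<Longrightarrow> s \<le> s' \<Longrightarrow> fwd b s N L \<le> fwd b s' N L"
  unfolding fwd_def by (intro hits_mono shell_mono finite_shell_X) auto

lemma unb_fwd_mono:
  assumes "L \<in> X_space" "s \<le> s'" "unbounded_above (\<lambda>N. fwd b s N L - \<beta> * real N)"
  shows "unbounded_above (\<lambda>N. fwd b s' N L - \<beta> * real N)"
  by (rule unb_shift_le[OF assms(3), of 0 _ 0]) (use fwd_mono[OF assms(1,2)] in auto)

text \<open>Two rational slopes, as \<open>balanced\<close> requires, are inserted between \<alpha>
  and \<beta>; the remaining gap turns a lower bound for the backward counts into
  unboundedness.\<close>

lemma balanced_fwd_bwd:
  assumes "balanced b L" "s \<in> \<rat>" "\<alpha> < \<beta>" "unbounded_above (\<lambda>N. fwd b s N L - \<beta> * real N)"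
  shows "unbounded_above (\<lambda>N. bwd b s N L - \<alpha> * real N)"
proof -
  obtain q2 where q2: "\<alpha> < of_rat q2" "of_rat q2 < \<beta>" using of_rat_dense[OF assms(3)] by blast
  obtain q1 where q1: "\<alpha> < of_rat q1" "of_rat q1 < (of_rat q2 :: real)" using of_rat_dense[OF q2(1)] by blast
  obtain r where r: "s = of_rat r" using assms(2) by (auto elim: Rats_cases)
  have "unbounded_above (\<lambda>N. fwd b s N L - of_rat q2 * real N)"
    using assms(4) by (rule unb_slope_mono) (use q2 in simp)
  moreover have "q1 < q2" using q1(2) by (simp add: of_rat_less)
  ultimately have "\<not> unbounded_above (\<lambda>N. of_rat q1 * real N - bwd b s N L)"
    using assms(1) unfolding balanced_def r by blast
  then show ?thesis by (rule unb_of_not_unb) (rule q1)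
qed

lemma balanced_bwd_fwd:
  assumes "balanced b L" "s \<in> \<rat>" "\<alpha> < \<beta>" "unbounded_above (\<lambda>N. bwd b s N L - \<beta> * real N)"
  shows "\<not> unbounded_above (\<lambda>N. \<alpha> * real N - fwd b s N L)"
proof
  assume unb: "unbounded_above (\<lambda>N. \<alpha> * real N - fwd b s N L)"
  obtain q2 where q2: "\<alpha> < of_rat q2" "of_rat q2 < \<beta>" using of_rat_dense[OF assms(3)] by blast
  obtain q1 where q1: "\<alpha> < of_rat q1" "of_rat q1 < (of_rat q2 :: real)" using of_rat_dense[OF q2(1)] by blast
  obtain r where r: "s = of_rat r" using assms(2) by (auto elim: Rats_cases)
  have "unbounded_above (\<lambda>N. bwd b s N L - of_rat q2 * real N)"
    using assms(4) by (rule unb_slope_mono) (use q2 in simp)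
  moreover have "unbounded_above (\<lambda>N. of_rat q1 * real N - fwd b s N L)"
    using unb by (rule unb_slope_mono') (use q1 in simp)
  moreover have "q1 < q2" using q1(2) by (simp add: of_rat_less)
  ultimately show False using assms(1) unfolding balanced_def r by blast
qed

text \<open>Changing \<open>a\<close> to \<open>b\<close> moves y + p a by p |b - a|, which tends to
  0 in the backward direction p -> 0. Below a threshold the shells are nested, and above it there
  are finitely many points, a number not depending on N.\<close>

lemma unb_bwd_shear:
  assumes L: "L \<in> X_space" and "s < s'" and unb: "unbounded_above (\<lambda>N. bwd a s N L - \<beta> * real N)"
  shows "unbounded_above (\<lambda>N. bwd b s' N L - \<beta> * real N)"
proof -
  \<comment> \<open>Below this height the displacement is at most s' - s; the added 1 keeps the
    denominator positive.\<close>
  define p where "p = (s' - s) / (norm (b - a) + 1)"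
  have "0 < norm (b - a) + 1" by (simp add: add_nonneg_pos)
  then have p: "0 < p" "p * (norm (b - a) + 1) = s' - s"
    using assms(2) by (auto simp: p_def divide_simps)
  have "bwd a s N L \<le> hits (shell a s p 1) L + bwd b s' N L" for N
    unfolding bwd_def
  proof (rule hits_le_add)
    have "v \<in> shell b s' (exp (- real N)) 1" if v: "v \<in> shell a s (exp (- real N)) 1" "pc v < p" for v
    proof -
      have "0 \<le> pc v" using v by (auto simp: shell_def light_cone_iff)
      have "norm (yc v + pc v *\<^sub>R b) \<le> norm (yc v + pc v *\<^sub>R a) + norm (pc v *\<^sub>R (b - a))"
        using norm_triangle_ineq[of "yc v + pc v *\<^sub>R a" "pc v *\<^sub>R (b - a)"] by (simp add: algebra_simps)
      also have "norm (pc v *\<^sub>R (b - a)) \<le> p * (norm (b - a) + 1)"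
        using v \<open>0 \<le> pc v\<close> by (auto intro!: mult_mono)
      finally show ?thesis using v p by (auto simp: shell_def)
    qed
    then show "shell a s (exp (- real N)) 1 \<inter> L \<subseteq> shell a s p 1 \<union> shell b s' (exp (- real N)) 1"
      by (auto simp: shell_def not_less)
  qed (use L p in \<open>auto intro: finite_shell_X\<close>)
  then have "bwd a s N L - \<beta> * real N \<le> hits (shell a s p 1) L + (bwd b s' (N + 0) L - \<beta> * real (N + 0))" for N
    by (simp add: algebra_simps)
  then show ?thesis by (rule unb_shift_le[OF unb])
qed

section \<open>Elements of G fixing a ray\<close>

definition axis_p :: "'n::finite vec2" where "axis_p = light_vec 1 0 0"

lemma axis_p_coords [simp]: "pc axis_p = 1" "qc axis_p = 0" "yc axis_p = 0"
  by (simp_all add: axis_p_def)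

lemma axis_p_cone: "axis_p \<in> light_cone"
  by (simp add: light_cone_iff)

text \<open>\<open>qc\<close> is, up to sign, the pairing with \<open>axis_p\<close>.\<close>

lemma qc_fixing_axis:
  assumes "g \<in> G_Q" "g *v axis_p = \<sigma> *\<^sub>R axis_p"
  shows "\<sigma> * qc (g *v v) = qc v"
proof -
  have Q: "Qform (g *v x) = Qform x" for x
    using assms(1) G_Q_subset by (auto simp: SO_Q_def)
  \<comment> \<open>Adding \<open>axis_p\<close> to \<open>v\<close> lowers \<open>Qform\<close> by
    exactly \<open>qc v\<close>; adding \<open>\<sigma> *\<^sub>R axis_p\<close> to
    \<open>g *v v\<close> lowers it by \<open>\<sigma> * qc (g *v v)\<close>.\<close>
  have "Qform (g *v v + \<sigma> *\<^sub>R axis_p) = Qform (v + axis_p)"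
    using Q[of "v + axis_p"] by (simp add: matrix_vector_right_distrib assms(2))
  with Q[of v] show ?thesis by (simp add: Qform_coords algebra_simps)
qed

context siegel_space
begin

text \<open>Elements fixing the ray of \<open>axis_p\<close> change the coordinates of a far away vector near that ray
  only by the factors \<open>\<sigma>\<close> and \<open>1 / \<sigma>\<close>, up to a bounded error in \<open>pc\<close>.\<close>

lemma unb_fwd_fixing_axis:
  fixes L :: "'n vec2 set"
  assumes L: "L \<in> X_space" and g: "g \<in> G_Q" and ray: "g *v axis_p = \<sigma> *\<^sub>R axis_p" and "0 < \<sigma>"
    and s: "0 < s" "s < s'" and unb: "unbounded_above (\<lambda>N. fwd 0 s N L - \<beta> * real N)"
  shows "unbounded_above (\<lambda>N. fwd 0 s' N (translate g L) - \<beta> * real N)"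
proof -
  have "linear (\<lambda>x. pc (g *v x))"
    using linear_compose[OF matrix_vector_mul_linear pc_linear] by (simp add: o_def)
  then obtain B where B: "B > 0" "\<And>x. norm (pc (g *v x)) \<le> B * norm x"
    using linear_bounded_pos by blast
  \<comment> \<open>Counted vectors have |y| < s and, as p >= 1, q <= s^2; so \<open>C\<close>
    bounds the contribution of y and q to the new \<open>pc\<close>.\<close>
  define C where "C = B * (s + s\<^sup>2)"
  have "0 < C" using B s by (simp add: C_def add_pos_pos)
  have ss: "0 < s'\<^sup>2 - s\<^sup>2" using s by (simp add: power_strict_mono)
  \<comment> \<open>Three demands on the threshold: p >= 1, an image height of at least \<sigma> p -
    C >= 1, and an increase of |y|^2 by at most s'^2 - s^2.\<close>
  define p where "p = max 1 (max ((1 + C) / \<sigma>) (C * s\<^sup>2 / (\<sigma> * (s'\<^sup>2 - s\<^sup>2))))"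
  have p: "1 \<le> p" "1 + C \<le> \<sigma> * p" "C * s\<^sup>2 / (\<sigma> * p) \<le> s'\<^sup>2 - s\<^sup>2"
  proof -
    show "1 \<le> p" by (simp add: p_def)
    have "(1 + C) / \<sigma> \<le> p" by (simp add: p_def)
    then show "1 + C \<le> \<sigma> * p" using \<open>0 < \<sigma>\<close> by (simp add: field_simps)
    have "C * s\<^sup>2 / (\<sigma> * (s'\<^sup>2 - s\<^sup>2)) \<le> p" by (simp add: p_def)
    then show "C * s\<^sup>2 / (\<sigma> * p) \<le> s'\<^sup>2 - s\<^sup>2"
      using \<open>0 < \<sigma>\<close> ss \<open>1 \<le> p\<close> by (simp add: divide_le_eq mult_ac)
  qed
  \<comment> \<open>The image height is at most (\<sigma> + C) p, which costs a fixed number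
    \<open>k\<close> of extra time steps.\<close>
  obtain k :: nat where k: "\<sigma> + C \<le> exp (real k)"
  proof -
    obtain k :: nat where "\<sigma> + C \<le> real k" using real_arch_simple by blast
    also have "real k \<le> exp (real k)" using exp_ge_add_one_self[of "real k"] by linarith
    finally show ?thesis using that by blast
  qed
  have "fwd 0 s N L \<le> hits (shell 0 s 1 p) L + fwd 0 s' (N + k) (translate g L)" for N
    unfolding fwd_def hits_translate[OF g]
  proof (rule hits_le_add)
    have "g *v v \<in> shell 0 s' 1 (exp (real (N + k)))"
      if v: "v \<in> shell 0 s 1 (exp (real N))" "p \<le> pc v" for v
    proof -
      have cone: "v \<in> light_cone" and y: "norm (yc v) < s" and pv: "pc v < exp (real N)"
        using v by (auto simp: shell_def)
      have q: "0 \<le> qc v" "qc v \<le> s\<^sup>2 / p" "qc v \<le> s\<^sup>2 / 1"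
        using cone qc_le_of_cone[OF cone, of p s] qc_le_of_cone[OF cone, of 1 s] v(2) p(1) y
        by (auto simp: light_cone_iff)
      define l where "l = pc (g *v light_vec 0 (qc v) (yc v))"
      have "v = pc v *\<^sub>R axis_p + light_vec 0 (qc v) (yc v)" by (simp add: light_coord_eq_iff)
      then have "g *v v = (pc v * \<sigma>) *\<^sub>R axis_p + g *v light_vec 0 (qc v) (yc v)"
        by (metis matrix_vector_right_distrib matrix_vector_mult_scaleR ray scaleR_scaleR)
      then have pc': "pc (g *v v) = \<sigma> * pc v + l" by (simp add: l_def)
      have "norm (light_vec 0 (qc v) (yc v)) \<le> s + s\<^sup>2"
        using norm_le_coords[of "light_vec 0 (qc v) (yc v)"] y q by simp
      then have "B * norm (light_vec 0 (qc v) (yc v)) \<le> C"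
        unfolding C_def using B by (intro mult_left_mono) auto
      then have l: "\<bar>l\<bar> \<le> C" using B(2)[of "light_vec 0 (qc v) (yc v)"] by (simp add: l_def)
      have gcone: "g *v v \<in> light_cone" by (rule G_cone[OF g cone])
      have "\<sigma> * p \<le> \<sigma> * pc v" using v(2) \<open>0 < \<sigma>\<close> by simp
      then have 1: "1 \<le> pc (g *v v)" using pc' l p(2) by linarith
      have "l \<le> C * pc v"
        using l \<open>0 < C\<close> v(2) p(1) mult_left_mono[of 1 "pc v" C] by linarith
      then have "pc (g *v v) \<le> (\<sigma> + C) * pc v" using pc' by (simp add: algebra_simps)
      also have "\<dots> \<le> exp (real k) * pc v" using k v(2) p(1) by (intro mult_right_mono) auto
      also have "\<dots> < exp (real k) * exp (real N)" using pv by simp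
      finally have 2: "pc (g *v v) < exp (real (N + k))" by (simp add: exp_add mult.commute)
      \<comment> \<open>The cone equation |y|^2 = p q also holds for the image, where p becomes
        \<sigma> p + l and q becomes q / \<sigma>. The product changes by l q / \<sigma>, which is
        small since q <= s^2 / \<open>p\<close> beyond the threshold \<open>p\<close>.\<close>
      have "(norm (yc (g *v v)))\<^sup>2 = pc (g *v v) * qc (g *v v)"
        using gcone by (simp add: light_cone_iff power2_norm_eq_inner)
      also have "\<dots> = pc v * qc v + l * (qc v / \<sigma>)"
        using \<open>0 < \<sigma>\<close> unfolding pc' qc_fixing_axis[OF g ray, of v, symmetric] by (simp add: field_simps)
      also have "l * (qc v / \<sigma>) \<le> C * ((s\<^sup>2 / p) / \<sigma>)"
        using l q \<open>0 < \<sigma>\<close> \<open>0 < C\<close> by (intro mult_mono divide_right_mono) auto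
      also have "C * ((s\<^sup>2 / p) / \<sigma>) \<le> s'\<^sup>2 - s\<^sup>2" using p(3) by (simp add: mult.commute)
      also have "pc v * qc v = (norm (yc v))\<^sup>2"
        using cone by (simp add: light_cone_iff power2_norm_eq_inner)
      finally have "(norm (yc (g *v v)))\<^sup>2 \<le> (norm (yc v))\<^sup>2 + (s'\<^sup>2 - s\<^sup>2)" by simp
      moreover have "(norm (yc v))\<^sup>2 < s\<^sup>2" using y by (intro power_strict_mono) auto
      ultimately have "(norm (yc (g *v v)))\<^sup>2 < s'\<^sup>2" by linarith
      then have 3: "norm (yc (g *v v)) < s'" using s by (intro power2_less_imp_less[of _ s']) auto
      show ?thesis using gcone 1 2 3 by (simp add: shell_def)
    qed
    moreover have "v \<in> shell 0 s 1 p" if "v \<in> shell 0 s 1 (exp (real N))" "\<not> p \<le> pc v" for v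
      using that by (simp add: shell_def)
    ultimately show "shell 0 s 1 (exp (real N)) \<inter> L \<subseteq> shell 0 s 1 p \<union> {v. g *v v \<in> shell 0 s' 1 (exp (real (N + k)))}"
      by blast
    have "finite (shell 0 s' 1 (exp (real (N + k))) \<inter> translate g L)"
      by (intro finite_shell_X translate_X_space g L) simp
    moreover have "(*v) g ` ({v. g *v v \<in> shell 0 s' 1 (exp (real (N + k)))} \<inter> L)
        \<subseteq> shell 0 s' 1 (exp (real (N + k))) \<inter> translate g L"
      by (auto simp: translate_def)
    ultimately show "finite ({v. g *v v \<in> shell 0 s' 1 (exp (real (N + k)))} \<inter> L)"
      using inj_G_Q[OF g] by (meson finite_imageD finite_subset inj_on_subset subset_UNIV)
  qed (use L p in \<open>auto intro: finite_shell_X\<close>)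
  then have "fwd 0 s N L - \<beta> * real N \<le> (hits (shell 0 s 1 p) L + \<beta> * real k) +
      (fwd 0 s' (N + k) (translate g L) - \<beta> * real (N + k))" for N
    by (simp add: algebra_simps)
  then show ?thesis by (rule unb_shift_le[OF unb])
qed

end

section \<open>Hopf's argument\<close>

lemma shear_axis: "shear b *v axis_p = light_vec 1 (b \<bullet> b) b"
  by (simp add: light_coord_eq_iff)

text \<open>The rays \<open>shear (- b) *v axis_p\<close> form a chart of the sphere of rays in the cone;
  \<open>mobius h\<close> is the action of \<open>h\<close> on this sphere in the chart.\<close>

definition chart_image :: "'n mat2 \<Rightarrow> real ^ 'n \<Rightarrow> 'n::finite vec2" where
  "chart_image h b = h *v (shear (- b) *v axis_p)"

definition mobius :: "'n::finite mat2 \<Rightarrow> real ^ 'n \<Rightarrow> real ^ 'n" where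
  "mobius h b = - (inverse (pc (chart_image h b)) *\<^sub>R yc (chart_image h b))"

text \<open>A quadratic polynomial in \<open>b\<close>, because \<open>shear (- b) *v axis_p\<close>
  has coordinates 1, \<open>b \<bullet> b\<close> and \<open>- b\<close>.\<close>

lemma differentiable_chart_image: "chart_image h differentiable (at b)"
proof -
  have eq: "chart_image h = (\<lambda>b. h *v light_vec 1 0 0 + (b \<bullet> b) *\<^sub>R (h *v light_vec 0 1 0) + h *v light_vec 0 0 (- b))"
    unfolding chart_image_def[abs_def] shear_axis
    by (simp add: matrix_vector_mult_scaleR[symmetric] matrix_vector_right_distrib[symmetric] fun_eq_iff)
      (intro allI arg_cong[where f = "(*v) h"], simp add: light_coord_eq_iff)
  have "linear (\<lambda>b. light_vec 0 0 (- b) :: 'a vec2)"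
    by (rule linearI) (simp_all add: light_coord_eq_iff)
  then have "linear (\<lambda>b. h *v light_vec 0 0 (- b))"
    using linear_compose[OF _ matrix_vector_mul_linear[of h]] by (auto simp: o_def)
  then show ?thesis
    unfolding eq
    by (intro differentiable_add differentiable_const differentiable_scaleR differentiable_inner
        differentiable_ident linear_imp_differentiable)
qed

lemma differentiable_mobius:
  assumes "pc (chart_image h b) \<noteq> 0"
  shows "mobius h differentiable (at b)"
proof -
  have "(\<lambda>b. pc (chart_image h b)) differentiable (at b)" "(\<lambda>b. yc (chart_image h b)) differentiable (at b)"
    using differentiable_chain_at[OF differentiable_chart_image linear_imp_differentiable[OF pc_linear]]
      differentiable_chain_at[OF differentiable_chart_image linear_imp_differentiable[OF yc_linear]]
    by (simp_all add: o_def)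
  then show ?thesis
    unfolding mobius_def[abs_def]
    by (intro differentiable_minus differentiable_scaleR differentiable_inverse assms)
qed

context siegel_space
begin

text \<open>\<open>mobius h b\<close> is chosen to cancel y; on the cone with p > 0 this forces q =
  0 as well.\<close>

lemma shear_mobius:
  fixes h :: "'n mat2"
  assumes "h \<in> G_Q" "pc (chart_image h b) > 0"
  shows "shear (mobius h b) *v chart_image h b = pc (chart_image h b) *\<^sub>R axis_p"
proof -
  let ?z = "chart_image h b"
  have "?z \<in> light_cone"
    unfolding chart_image_def by (intro G_cone assms(1) shear_cone axis_p_cone)
  then have "shear (mobius h b) *v ?z \<in> light_cone" by (rule shear_cone)
  moreover have "yc (shear (mobius h b) *v ?z) = 0"
    using assms(2) by (simp add: mobius_def)
  moreover have p: "pc (shear (mobius h b) *v ?z) = pc ?z" by (rule shear_coords)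
  ultimately have "qc (shear (mobius h b) *v ?z) = 0"
    using assms(2) unfolding light_cone_iff p by auto
  then show ?thesis
    using \<open>yc (shear (mobius h b) *v ?z) = 0\<close> p by (simp only: light_coord_eq_iff) simp
qed

text \<open>The ray with parameter \<open>mobius h b\<close> is the image under \<open>h\<close> of
  the ray with parameter \<open>b\<close>, so the inverse \<open>h'\<close> leads back to the
  latter.\<close>

lemma chart_image_mobius:
  fixes h :: "'n mat2"
  assumes "h \<in> G_Q" "pc (chart_image h b) > 0" "h' ** h = mat 1"
  shows "chart_image h' (mobius h b) = inverse (pc (chart_image h b)) *\<^sub>R (shear (- b) *v axis_p)"
proof -
  let ?z = "chart_image h b"
  have "?z = pc ?z *\<^sub>R (shear (- mobius h b) *v axis_p)"
  proof -
    have "?z = shear (- mobius h b) *v (shear (mobius h b) *v ?z)"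
      by (simp only: matrix_vector_mul_assoc shear_add) simp
    then show ?thesis
      by (simp only: shear_mobius[OF assms(1,2)] matrix_vector_mult_scaleR)
  qed
  then have "shear (- mobius h b) *v axis_p = inverse (pc ?z) *\<^sub>R ?z"
    using assms(2) by (metis less_irrefl scaleR_one scaleR_scaleR left_inverse)
  then have "chart_image h' (mobius h b) = inverse (pc ?z) *\<^sub>R (h' *v ?z)"
    by (simp only: chart_image_def[of h' "mobius h b"] matrix_vector_mult_scaleR)
  also have "h' *v ?z = shear (- b) *v axis_p"
    unfolding chart_image_def by (simp only: matrix_vector_mul_assoc[of h' h] assms(3) matrix_vector_mul_lid)
  finally show ?thesis .
qed

text \<open>The points of the cone with p = 0 have y = 0 and thus form a single ray; its preimage
  under the injective \<open>h\<close> lies on one line.\<close>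

lemma collinear_of_pc_eq_0:
  fixes h :: "'n mat2"
  assumes h: "h \<in> G_Q" and x: "x \<in> light_cone" "y \<in> light_cone" and "x \<noteq> 0"
    and pc: "pc (h *v x) = 0" "pc (h *v y) = 0"
  shows "\<exists>c. y = c *\<^sub>R x"
proof -
  have axis: "h *v z = qc (h *v z) *\<^sub>R light_vec 0 1 0" if "z \<in> light_cone" "pc (h *v z) = 0" for z
    using G_cone[OF h that(1)] that(2) by (simp add: light_cone_iff light_coord_eq_iff)
  have hx: "h *v x \<noteq> 0"
  proof
    assume "h *v x = 0"
    then have "h *v x = h *v 0" by simp
    with \<open>x \<noteq> 0\<close> inj_G_Q[OF h] show False by (meson injD)
  qed
  define q where "q = qc (h *v x)"
  define r where "r = qc (h *v y)"
  have hq: "h *v x = q *\<^sub>R light_vec 0 1 0" "h *v y = r *\<^sub>R light_vec 0 1 0"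
    using axis[OF x(1) pc(1)] axis[OF x(2) pc(2)] by (simp_all only: q_def r_def)
  then have "q \<noteq> 0" using hx by auto
  with hq have "h *v y = h *v ((r / q) *\<^sub>R x)"
    by (simp add: matrix_vector_mult_scaleR)
  then show ?thesis using inj_G_Q[OF h] by (meson injD)
qed

text \<open>Otherwise \<open>h\<close> would send all rays of the chart into the ray p = 0, but the
  rays with parameters 0 and 1 (the all-ones vector) are not collinear.\<close>

lemma chart_image_pos:
  fixes h :: "'n mat2"
  assumes h: "h \<in> G_Q"
  shows "\<exists>b. 0 < pc (chart_image h b)"
proof (rule ccontr)
  assume neg: "\<nexists>b. 0 < pc (chart_image h b)"
  let ?x = "\<lambda>b. shear (- b) *v axis_p :: 'n vec2"
  have cone: "?x b \<in> light_cone" for b by (intro shear_cone axis_p_cone)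
  have "pc (h *v ?x b) = 0" for b
  proof -
    have "\<not> 0 < pc (h *v ?x b)" using neg by (auto simp: chart_image_def)
    moreover have "0 \<le> pc (h *v ?x b)" using G_cone[OF h cone] by (simp only: light_cone_iff)
    ultimately show ?thesis by linarith
  qed
  moreover have "?x 0 \<noteq> 0" by (simp add: light_coord_eq_iff)
  ultimately obtain k where "?x 1 = k *\<^sub>R ?x 0"
    using collinear_of_pc_eq_0[OF h cone cone] by blast
  then show False by (simp add: light_coord_eq_iff)
qed

text \<open>The parameters to be avoided are those in \<open>N1\<close> and those that
  \<open>mobius h\<close> sends into \<open>N2\<close>. The latter lie in the image of a subset of
  \<open>N2\<close> under the differentiable map \<open>mobius h'\<close>, which is negligible,
  while the domain \<open>U\<close> is open and nonempty.\<close>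

lemma mobius_choice:
  fixes h :: "'n mat2"
  assumes h: "h \<in> G_Q" and N: "negligible N1" "negligible N2"
  obtains b1 b2 \<sigma> where "b1 \<notin> N1" "b2 \<notin> N2" "0 < \<sigma>"
    "(shear b2 ** h ** shear (- b1)) *v axis_p = \<sigma> *\<^sub>R axis_p"
proof -
  obtain h' where h': "h' \<in> G_Q" "h' ** h = mat 1" using G_Q_inverse[OF h] by blast
  define U where "U = {b. 0 < pc (chart_image h b)}"
  define N2' where "N2' = {b \<in> N2. 0 < pc (chart_image h' b)}"
  have "continuous_on UNIV (chart_image h)"
    using differentiable_chart_image differentiable_imp_continuous_within
    by (blast intro: continuous_at_imp_continuous_on)
  then have "continuous_on UNIV (\<lambda>b. pc (chart_image h b))"
    by (rule continuous_on_compose2[OF continuous_coords(1)]) auto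
  then have "open U" unfolding U_def by (intro open_Collect_less continuous_on_const) auto
  moreover have "U \<noteq> {}" using chart_image_pos[OF h] by (auto simp: U_def)
  ultimately have U: "\<not> negligible U" by (rule open_not_negligible)
  have "negligible (mobius h' ` N2')"
  proof (rule negligible_differentiable_image_negligible)
    show "negligible N2'" using N(2) by (rule negligible_subset) (auto simp: N2'_def)
    show "mobius h' differentiable_on N2'"
      by (rule differentiable_at_imp_differentiable_on) (auto simp: N2'_def intro: differentiable_mobius)
  qed simp
  with N(1) have "negligible (N1 \<union> mobius h' ` N2')" by (rule negligible_Un)
  with U have "\<not> U \<subseteq> N1 \<union> mobius h' ` N2'" using negligible_subset by blast
  then obtain b where b: "0 < pc (chart_image h b)" "b \<notin> N1" "b \<notin> mobius h' ` N2'"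
    by (auto simp: U_def)
  have "mobius h b \<notin> N2"
  proof
    assume "mobius h b \<in> N2"
    have inv: "chart_image h' (mobius h b) = inverse (pc (chart_image h b)) *\<^sub>R (shear (- b) *v axis_p)"
      by (rule chart_image_mobius[OF h b(1) h'(2)])
    then have "0 < pc (chart_image h' (mobius h b))" using b(1) by simp
    then have "mobius h b \<in> N2'" using \<open>mobius h b \<in> N2\<close> by (simp add: N2'_def)
    moreover have "mobius h' (mobius h b) = b" unfolding mobius_def[of h'] inv using b(1) by simp
    ultimately show False using b(3) by (metis imageI)
  qed
  moreover have "(shear (mobius h b) ** h ** shear (- b)) *v axis_p = pc (chart_image h b) *\<^sub>R axis_p"
    using shear_mobius[OF h b(1)]
    by (simp only: chart_image_def matrix_vector_mul_assoc matrix_mul_assoc)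
  ultimately show ?thesis using that b by blast
qed

section \<open>Generic points and the transfer of forward densities\<close>

definition good :: "'n vec2 set \<Rightarrow> bool" where
  "good L \<longleftrightarrow> balanced 0 L \<and> (AE b in lborel. balanced b L)"

lemma AE_good: "AE L in mu. good L"
  using AE_balanced AE_AE_balanced by (auto simp: good_def)

lemma good_negligible:
  assumes "good L" obtains N where "negligible N" "\<And>b. b \<notin> N \<Longrightarrow> balanced b L"
proof -
  have "AE b in lebesgue. balanced b L" using assms by (auto simp: good_def intro: AE_completion)
  then show ?thesis using that by (auto simp: eventually_ae_filter_negligible)
qed

text \<open>Hopf's argument: go from \<open>L1\<close> to \<open>L2\<close> along a shear, which preserves backward densities,
  an element fixing the ray of \<open>axis_p\<close>, which preserves forward densities, and another shear,
  all intermediate points being balanced.\<close>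

lemma unb_fwd_transfer:
  assumes X: "L1 \<in> X_space" "L2 \<in> X_space" and good: "good L1" "good L2"
    and s: "0 < s" "s < s'" and "\<alpha> < \<beta>" and unb: "unbounded_above (\<lambda>N. fwd 0 s N L1 - \<beta> * real N)"
  shows "\<not> unbounded_above (\<lambda>N. \<alpha> * real N - fwd 0 s' N L2)"
proof -
  \<comment> \<open>Each shear and the ray-fixing element require a strictly larger radius, and
    \<open>balanced\<close> speaks of rational radii. The slopes decrease whenever
    \<open>balanced\<close> or \<open>unb_of_not_unb\<close> is used.\<close>
  obtain s1 where s1: "s1 \<in> \<rat>" "s < s1" "s1 < s'" using Rats_dense_in_real[OF s(2)] by blast
  obtain s2 where s2: "s2 \<in> \<rat>" "s1 < s2" "s2 < s'" using Rats_dense_in_real[OF s1(3)] by blast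
  obtain s3 where s3: "s3 \<in> \<rat>" "s2 < s3" "s3 < s'" using Rats_dense_in_real[OF s2(3)] by blast
  obtain s4 where s4: "s4 \<in> \<rat>" "s3 < s4" "s4 < s'" using Rats_dense_in_real[OF s3(3)] by blast
  obtain \<beta>1 where \<beta>1: "\<alpha> < \<beta>1" "\<beta>1 < \<beta>" using dense[OF \<open>\<alpha> < \<beta>\<close>] by blast
  obtain \<beta>2 where \<beta>2: "\<alpha> < \<beta>2" "\<beta>2 < \<beta>1" using dense[OF \<beta>1(1)] by blast
  obtain \<beta>3 where \<beta>3: "\<alpha> < \<beta>3" "\<beta>3 < \<beta>2" using dense[OF \<beta>2(1)] by blast
  obtain \<beta>4 where \<beta>4: "\<alpha> < \<beta>4" "\<beta>4 < \<beta>3" using dense[OF \<beta>3(1)] by blast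
  obtain h where h: "h \<in> G_Q" "translate h L1 = L2" using X_space_transitive[OF X] by blast
  obtain N1 where N1: "negligible N1" "\<And>b. b \<notin> N1 \<Longrightarrow> balanced b L1" using good_negligible[OF good(1)] by blast
  obtain N2 where N2: "negligible N2" "\<And>b. b \<notin> N2 \<Longrightarrow> balanced b L2" using good_negligible[OF good(2)] by blast
  obtain b1 b2 \<sigma> where b: "b1 \<notin> N1" "b2 \<notin> N2" "0 < \<sigma>"
    and ray: "(shear b2 ** h ** shear (- b1)) *v axis_p = \<sigma> *\<^sub>R axis_p"
    using mobius_choice[OF h(1) N1(1) N2(1)] .
  let ?g = "shear b2 ** h ** shear (- b1)"
  have g: "?g \<in> G_Q" by (intro G_Q_mult shear_G h)
  have gL: "translate ?g (translate (shear b1) L1) = translate (shear b2) L2"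
  proof -
    have "translate (shear (- b1)) (translate (shear b1) L1) = L1"
      by (simp add: shear_add flip: translate_mult)
    then show ?thesis by (simp add: translate_mult h(2))
  qed
  have s2_pos: "0 < s2" using s(1) s1(2) s2(2) by linarith
  have fwd_shear: "fwd 0 s N (translate (shear b) L) = fwd b s N L" if "L \<in> X_space"
    for s N b and L :: "'n vec2 set"
    using that by (simp add: fwd_def hits_shear)
  have "unbounded_above (\<lambda>N. fwd 0 s1 N L1 - \<beta> * real N)"
    using unb_fwd_mono[OF X(1) _ unb] s1 by simp
  then have "unbounded_above (\<lambda>N. bwd 0 s1 N L1 - \<beta>1 * real N)"
    by (rule balanced_fwd_bwd[rotated 3]) (use good s1 \<beta>1 in \<open>auto simp: good_def\<close>)
  then have "unbounded_above (\<lambda>N. bwd b1 s2 N L1 - \<beta>1 * real N)"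
    by (rule unb_bwd_shear[OF X(1) s2(2)])
  then have "\<not> unbounded_above (\<lambda>N. \<beta>2 * real N - fwd b1 s2 N L1)"
    by (rule balanced_bwd_fwd[OF N1(2)[OF b(1)] s2(1) \<beta>2(2)])
  then have "unbounded_above (\<lambda>N. fwd b1 s2 N L1 - \<beta>3 * real N)"
    by (rule unb_of_not_unb) (rule \<beta>3)
  then have "unbounded_above (\<lambda>N. fwd 0 s2 N (translate (shear b1) L1) - \<beta>3 * real N)"
    by (simp add: fwd_shear X)
  then have "unbounded_above (\<lambda>N. fwd 0 s3 N (translate (shear b2) L2) - \<beta>3 * real N)"
    unfolding gL[symmetric]
    by (rule unb_fwd_fixing_axis[OF translate_X_space[OF shear_G X(1)] g ray b(3) s2_pos s3(2)])
  then have "unbounded_above (\<lambda>N. fwd b2 s3 N L2 - \<beta>3 * real N)"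
    by (simp add: fwd_shear X)
  then have "unbounded_above (\<lambda>N. bwd b2 s3 N L2 - \<beta>4 * real N)"
    by (rule balanced_fwd_bwd[OF N2(2)[OF b(2)] s3(1) \<beta>4(2)])
  then have "unbounded_above (\<lambda>N. bwd 0 s4 N L2 - \<beta>4 * real N)"
    by (rule unb_bwd_shear[OF X(2) s4(2)])
  then have not_unb: "\<not> unbounded_above (\<lambda>N. \<alpha> * real N - fwd 0 s4 N L2)"
    by (rule balanced_bwd_fwd[rotated 3]) (use good s4 \<beta>4 in \<open>auto simp: good_def\<close>)
  show ?thesis
  proof
    assume "unbounded_above (\<lambda>N. \<alpha> * real N - fwd 0 s' N L2)"
    then have "unbounded_above (\<lambda>N. \<alpha> * real N - fwd 0 s4 N L2)"
      by (rule unb_shift_le[of _ 0 _ 0]) (use fwd_mono[OF X(2), of s4 s'] s4 in auto)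
    with not_unb show False ..
  qed
qed

end

section \<open>The limit of the densities\<close>

context siegel_space
begin

text \<open>By the mean value formula this is the mean of one step of the orbit sum
  \<open>fwd 0 s\<close>.\<close>

definition shell_mass :: "real \<Rightarrow> real" where
  "shell_mass s = measure lam (shell 0 s 1 (exp 1))"

text \<open>Compares slopes with the mean: in the applications \<open>c\<close> is 1 or -1, for
  forward counts running above or below a line.\<close>

lemma integral_affine_nonneg_of_unb:
  assumes "AE L in mu. unbounded_above (\<lambda>N. c * fwd 0 s N L + d * real N)"
  shows "0 \<le> c * shell_mass s + d"
proof -
  let ?F = "hits (shell 0 s 1 (exp 1)) :: 'n vec2 set \<Rightarrow> real"
  interpret T: measure_preserving_map mu "translate (boost (- 1))"
    by (rule measure_preserving_translate[OF boost_G])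
  have "AE L in mu. unbounded_above (\<lambda>N. orbit_sum (translate (boost (- 1))) (\<lambda>L. c * ?F L + d) N L)"
    using assms unfolding orbit_sum_affine
    by (rule AE_mp[OF _ AE_I2]) (simp add: space_mu orbit_sum_fwd)
  then have "0 \<le> (\<integral>L. c * ?F L + d \<partial>mu)"
    by (rule T.integral_nonneg_of_unb[OF integrable_affine_hits])
  also have "\<dots> = c * shell_mass s + d"
    using integrable_hits[OF shell_sets_lam bounded_shell, of 1 0 s "exp 1"]
      integral_hits[OF shell_sets_lam bounded_shell, of 1 0 s "exp 1"]
    by (simp add: shell_mass_def prob_space)
  finally show ?thesis .
qed

text \<open>Some good point has unbounded excess over the slope \<beta>: otherwise almost all
  forward counts would stay below \<beta> N up to constants, and the mean would be at most \<beta>'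
  < \<open>shell_mass s\<close>. \<open>unb_fwd_transfer\<close> then carries a lower bound from
  this single point to every good point.\<close>

lemma AE_fwd_lower:
  assumes s: "0 < s" "s < s'" and "\<alpha> < shell_mass s"
  shows "AE L in mu. \<not> unbounded_above (\<lambda>N. \<alpha> * real N - fwd 0 s' N L)"
proof -
  obtain \<beta> where \<beta>: "\<alpha> < \<beta>" "\<beta> < shell_mass s" using dense[OF assms(3)] by blast
  obtain \<beta>' where \<beta>': "\<beta> < \<beta>'" "\<beta>' < shell_mass s" using dense[OF \<beta>(2)] by blast
  have "\<exists>L\<in>X_space. good L \<and> unbounded_above (\<lambda>N. fwd 0 s N L - \<beta> * real N)"
  proof (rule ccontr)
    assume *: "\<not> (\<exists>L\<in>X_space. good L \<and> unbounded_above (\<lambda>N. fwd 0 s N L - \<beta> * real N))"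
    have "unbounded_above (\<lambda>N. - 1 * fwd 0 s N L + \<beta>' * real N)" if "L \<in> X_space" "good L" for L
    proof -
      have "\<not> unbounded_above (\<lambda>N. fwd 0 s N L - \<beta> * real N)" using * that by blast
      then have "\<not> unbounded_above (\<lambda>N. (- \<beta>) * real N - (- fwd 0 s N L))" by simp
      from unb_of_not_unb[OF this, of "- \<beta>'"] \<beta>' show ?thesis by simp
    qed
    then have "AE L in mu. unbounded_above (\<lambda>N. - 1 * fwd 0 s N L + \<beta>' * real N)"
      using AE_good by (auto simp: space_mu intro: AE_mp[OF AE_good AE_I2])
    from integral_affine_nonneg_of_unb[OF this] \<beta>' show False by simp
  qed
  then obtain L1 where L1: "L1 \<in> X_space" "good L1" "unbounded_above (\<lambda>N. fwd 0 s N L1 - \<beta> * real N)" by blast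
  show ?thesis
    by (rule AE_mp[OF AE_good AE_I2])
      (use unb_fwd_transfer[OF L1(1) _ L1(2) _ s \<beta>(1) L1(3)] in \<open>auto simp: space_mu\<close>)
qed

text \<open>A single good exceptional point gives a contradiction: it forces slope \<alpha> at
  radius s' on all good points, so the mean would be at least \<alpha>' >
  \<open>shell_mass s'\<close>.\<close>

lemma AE_fwd_upper:
  assumes s: "0 < s" "s < s'" and "shell_mass s' < \<beta>"
  shows "AE L in mu. \<not> unbounded_above (\<lambda>N. fwd 0 s N L - \<beta> * real N)"
proof -
  obtain \<alpha> where \<alpha>: "shell_mass s' < \<alpha>" "\<alpha> < \<beta>" using dense[OF assms(3)] by blast
  obtain \<alpha>' where \<alpha>': "shell_mass s' < \<alpha>'" "\<alpha>' < \<alpha>" using dense[OF \<alpha>(1)] by blast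
  have "\<not> unbounded_above (\<lambda>N. fwd 0 s N L1 - \<beta> * real N)" if L1: "L1 \<in> X_space" "good L1" for L1
  proof
    assume unb: "unbounded_above (\<lambda>N. fwd 0 s N L1 - \<beta> * real N)"
    have "unbounded_above (\<lambda>N. 1 * fwd 0 s' N L + (- \<alpha>') * real N)" if "L \<in> X_space" "good L" for L
      using unb_of_not_unb[OF unb_fwd_transfer[OF L1(1) that(1) L1(2) that(2) s \<alpha>(2) unb] \<alpha>'(2)] by simp
    then have "AE L in mu. unbounded_above (\<lambda>N. 1 * fwd 0 s' N L + (- \<alpha>') * real N)"
      using AE_good by (auto simp: space_mu intro: AE_mp[OF AE_good AE_I2])
    from integral_affine_nonneg_of_unb[OF this] \<alpha>' show False by simp
  qed
  then show ?thesis
    by (intro AE_mp[OF AE_good AE_I2]) (auto simp: space_mu)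
qed

section \<open>Continuity and positivity of the mass of a shell\<close>

lemma sigma_finite_lam: "sigma_finite_measure lam"
proof
  let ?A = "range (\<lambda>n::nat. light_cone \<inter> cball (0 :: 'n vec2) (real n))"
  have sets: "light_cone \<inter> cball (0 :: 'n vec2) r \<in> sets lam" for r
    by (intro sets_lamI) auto
  have "bounded (light_cone \<inter> cball (0 :: 'n vec2) r)" for r by (simp add: bounded_Int)
  then have "emeasure lam (light_cone \<inter> cball 0 r) \<noteq> \<infinity>" for r
    using emeasure_bounded_cone[OF lam _ sets] by (metis less_irrefl)
  moreover have "\<Union> ?A = space lam"
    using real_arch_simple by (auto simp: space_lam)
  ultimately show "\<exists>A. countable A \<and> A \<subseteq> sets lam \<and> \<Union> A = space lam \<and> (\<forall>a\<in>A. emeasure lam a \<noteq> \<infinity>)"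
    using sets by (intro exI[of _ ?A]) auto
qed

definition side :: "real ^ 'n \<Rightarrow> real \<Rightarrow> 'n vec2 set" where
  "side b s = {v \<in> light_cone. 1 \<le> pc v \<and> pc v < exp 1 \<and> norm (yc v + pc v *\<^sub>R b) = s}"

lemma side_sets: "side b s \<in> sets lam"
proof (rule sets_lamI)
  have "side b s = {v \<in> space borel. v \<in> light_cone \<and> 1 \<le> pc v \<and> pc v < exp 1 \<and> norm (yc v + pc v *\<^sub>R b) = s}"
    by (auto simp: side_def)
  also have "\<dots> \<in> sets borel" by measurable
  finally show "side b s \<in> sets borel" .
qed (auto simp: side_def)

lemma emeasure_side: "emeasure lam (side b s) = emeasure lam (side 0 s)"
proof -
  have "(*v) (shear b) ` side b s = side 0 s"
  proof
    show "(*v) (shear b) ` side b s \<subseteq> side 0 s" by (auto simp: side_def intro: shear_cone)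
    show "side 0 s \<subseteq> (*v) (shear b) ` side b s"
    proof
      fix v assume v: "v \<in> side 0 s"
      have "v = shear b *v (shear (- b) *v v)" by (simp add: matrix_vector_mul_assoc shear_add)
      moreover have "shear (- b) *v v \<in> side b s" using v by (simp add: side_def shear_cone)
      ultimately show "v \<in> (*v) (shear b) ` side b s" by blast
    qed
  qed
  moreover have "emeasure lam ((*v) (shear b) ` side b s) = emeasure lam (side b s)"
    using lam shear_G[of b] side_sets[of b s]
    unfolding invariant_radon_cone_def invariant_measure_def by blast
  ultimately show ?thesis by simp
qed

text \<open>The sheared copies \<open>side b s\<close> all have the same measure, but a given vector lies on
  \<open>side b s\<close> only for \<open>b\<close> on a sphere.\<close>

lemma side_null: "side 0 s \<in> null_sets lam"
proof -
  interpret lam: sigma_finite_measure lam by (rule sigma_finite_lam)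
  interpret pair_sigma_finite lborel lam ..
  have [measurable]: "(\<lambda>w. snd w) \<in> (lborel :: (real ^ 'n) measure) \<Otimes>\<^sub>M lam \<rightarrow>\<^sub>M borel"
  proof -
    have "snd \<in> (lborel :: (real ^ 'n) measure) \<Otimes>\<^sub>M lam \<rightarrow>\<^sub>M restrict_space borel light_cone"
      using measurable_snd[of lborel lam] by (simp add: measurable_cong_sets[OF refl sets_lam])
    then show ?thesis by (simp add: measurable_restrict_space2_iff)
  qed
  have meas: "{w \<in> space (lborel \<Otimes>\<^sub>M lam). snd w \<notin> side (fst w) s} \<in> sets (lborel \<Otimes>\<^sub>M lam)"
    unfolding side_def mem_Collect_eq by measurable
  have "AE b in lborel. v \<notin> side b s" for v
  proof (cases "1 \<le> pc v")
    case True
    have "b \<in> sphere (- ((1 / pc v) *\<^sub>R yc v)) (s / pc v)" if "v \<in> side b s" for b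
    proof -
      have "yc v + pc v *\<^sub>R b = pc v *\<^sub>R (b + (1 / pc v) *\<^sub>R yc v)"
        using True by (simp add: algebra_simps)
      then have "pc v * norm (b + (1 / pc v) *\<^sub>R yc v) = s"
        using that True by (simp add: side_def)
      then show ?thesis using True by (auto simp: dist_norm norm_minus_commute field_simps)
    qed
    then have "AE b in lebesgue. v \<notin> side b s"
      unfolding eventually_ae_filter_negligible using negligible_sphere by blast
    then show ?thesis by (simp add: AE_completion_iff)
  next
    case False
    then show ?thesis by (simp add: side_def)
  qed
  then have "AE v in lam. AE b in lborel. v \<notin> side b s" by simp
  then have "AE b in lborel. AE v in lam. v \<notin> side b s"
    by (subst AE_commute[OF meas])
  moreover have "ae_filter (lborel :: (real ^ 'n) measure) \<noteq> bot"
    by (simp add: ae_filter_eq_bot_iff)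
  ultimately obtain b where "AE v in lam. v \<notin> side b s"
    using eventually_happens' by blast
  then have "side b s \<in> null_sets lam"
    by (subst AE_iff_null_sets[OF side_sets])
  then show ?thesis using side_sets emeasure_side[of b s] by (auto simp: null_sets_def)
qed

text \<open>The shells of larger radius decrease to the shell of radius s together with its lateral
  boundary \<open>side 0 s\<close>, which is a null set.\<close>

lemma shell_mass_right: "(\<lambda>n. shell_mass (s + inverse (real (Suc n)))) \<longlonglongrightarrow> shell_mass s"
proof -
  let ?A = "\<lambda>n. shell 0 (s + inverse (real (Suc n))) 1 (exp 1) :: 'n vec2 set"
  have "(\<lambda>n. measure lam (?A n)) \<longlonglongrightarrow> measure lam (\<Inter>n. ?A n)"
  proof (rule Lim_measure_decseq)
    show "decseq ?A"
      unfolding decseq_def by (intro allI impI shell_mono) (auto simp: field_simps)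
    show "emeasure lam (?A n) \<noteq> \<infinity>" for n
      using emeasure_bounded_cone[OF lam bounded_shell shell_sets_lam, of 1] by (simp add: less_top)
  qed (auto intro: shell_sets_lam)
  also have "(\<Inter>n. ?A n) = shell 0 s 1 (exp 1) \<union> side 0 s"
  proof (intro set_eqI iffI)
    fix v :: "'n vec2" assume v: "v \<in> (\<Inter>n. ?A n)"
    then have lt: "norm (yc v) < s + inverse (real (Suc n))" for n by (auto simp: shell_def)
    have "norm (yc v) \<le> s"
    proof (rule ccontr)
      assume "\<not> norm (yc v) \<le> s"
      then obtain n where "inverse (real (Suc n)) < norm (yc v) - s"
        using reals_Archimedean[of "norm (yc v) - s"] by auto
      with lt[of n] show False by simp
    qed
    with v show "v \<in> shell 0 s 1 (exp 1) \<union> side 0 s" by (auto simp: shell_def side_def)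
  next
    fix v :: "'n vec2" assume "v \<in> shell 0 s 1 (exp 1) \<union> side 0 s"
    then have "norm (yc v) \<le> s" by (auto simp: shell_def side_def)
    then have "norm (yc v) < s + inverse (real (Suc n))" for n
      by (rule le_less_trans) simp
    with \<open>v \<in> shell 0 s 1 (exp 1) \<union> side 0 s\<close> show "v \<in> (\<Inter>n. ?A n)"
      by (auto simp: shell_def side_def simp del: of_nat_Suc)
  qed
  also have "measure lam (shell 0 s 1 (exp 1) \<union> side 0 s) = shell_mass s"
    unfolding shell_mass_def by (rule measure_Un_null_set[OF shell_sets_lam side_null])
  finally show ?thesis by (simp add: shell_mass_def)
qed

text \<open>The strict inequality in \<open>shell\<close> makes it the union of the shells of
  smaller radius.\<close>

lemma shell_mass_left: "(\<lambda>n. shell_mass (s - inverse (real (Suc n)))) \<longlonglongrightarrow> shell_mass s"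
proof -
  let ?A = "\<lambda>n. shell 0 (s - inverse (real (Suc n))) 1 (exp 1) :: 'n vec2 set"
  have "(\<Union>n. ?A n) = shell 0 s 1 (exp 1)"
  proof (intro set_eqI iffI)
    fix v :: "'n vec2" assume "v \<in> (\<Union>n. ?A n)"
    then show "v \<in> shell 0 s 1 (exp 1)"
      by (auto simp: shell_def intro: less_trans[OF _ diff_less] simp del: of_nat_Suc)
        (smt (verit) inverse_positive_iff_positive of_nat_0_less_iff zero_less_Suc)
  next
    fix v :: "'n vec2" assume v: "v \<in> shell 0 s 1 (exp 1)"
    then obtain n where "inverse (real (Suc n)) < s - norm (yc v)"
      using reals_Archimedean[of "s - norm (yc v)"] by (auto simp: shell_def)
    with v show "v \<in> (\<Union>n. ?A n)" by (auto simp: shell_def simp del: of_nat_Suc intro!: exI[of _ n])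
  qed
  moreover have "(\<lambda>n. measure lam (?A n)) \<longlonglongrightarrow> measure lam (\<Union>n. ?A n)"
  proof (rule Lim_measure_incseq)
    show "incseq ?A"
      unfolding incseq_def by (intro allI impI shell_mono) (auto simp: field_simps)
    show "emeasure lam (\<Union>n. ?A n) \<noteq> \<infinity>"
      using emeasure_bounded_cone[OF lam bounded_shell shell_sets_lam, of 1 0 s "exp 1"] calculation
      by (simp add: less_top)
  qed (auto intro: shell_sets_lam)
  ultimately show ?thesis by (simp add: shell_mass_def)
qed

text \<open>With mass 0, almost every point of X would miss the shell and, by invariance, countably
  many sheared and boosted copies of it. These cover the part p > 0 of the cone, so some L would lie
  in the ray p = 0, although \<open>Lambda0\<close> meets two different rays.\<close>

lemma shell_mass_pos:
  assumes "0 < s"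
  shows "0 < shell_mass s"
proof (rule ccontr)
  assume "\<not> 0 < shell_mass s"
  then have "shell_mass s = 0" by (simp add: shell_mass_def measure_le_0_iff not_less)
  then have "(\<integral>L. hits (shell 0 s 1 (exp 1)) L \<partial>mu) = 0"
    by (simp add: shell_mass_def integral_hits[OF shell_sets_lam bounded_shell])
  then have AE0: "AE L in mu. hits (shell 0 s 1 (exp 1)) L = 0"
    using integrable_hits[OF shell_sets_lam bounded_shell, of 1 0 s "exp 1"]
    by (subst (asm) integral_nonneg_eq_0_iff_AE) (auto simp: hits_def)
  have AE1: "AE L in mu. hits (shell d s (exp (real_of_int k)) (exp (real_of_int k + 1))) L = 0" for d k
  proof -
    have "AE L in mu. hits (shell 0 s 1 (exp 1)) (translate (boost (- real_of_int k) ** shear d) L) = 0"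
      by (rule AE_translate[OF G_Q_mult[OF boost_G shear_G] AE0])
    then show ?thesis
      by (rule AE_mp[OF _ AE_I2])
        (simp add: translate_mult hits_boost hits_shear space_mu translate_X_space shear_G exp_add)
  qed
  obtain D :: "(real ^ 'n) set" where D: "countable D" "\<And>X. open X \<Longrightarrow> X \<noteq> {} \<Longrightarrow> \<exists>d\<in>D. d \<in> X"
    by (rule countable_dense_setE) auto
  have "AE L in mu. \<forall>d\<in>D. \<forall>k. hits (shell d s (exp (real_of_int k)) (exp (real_of_int k + 1))) L = 0"
    using AE1 by (subst AE_ball_countable[OF D(1)]) (simp add: AE_all_countable)
  then have "AE L in mu. L \<in> X_space \<and>
      (\<forall>d\<in>D. \<forall>k. hits (shell d s (exp (real_of_int k)) (exp (real_of_int k + 1))) L = 0)"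
    by (rule AE_mp[OF _ AE_I2]) (simp add: space_mu)
  then obtain L where L: "L \<in> X_space"
    "\<And>d k. d \<in> D \<Longrightarrow> hits (shell d s (exp (real_of_int k)) (exp (real_of_int k + 1))) L = 0"
    using eventually_happens'[OF ae_filter_bot] by blast
  have pc0: "pc v = 0" if v: "v \<in> L" for v
  proof (rule ccontr)
    assume "pc v \<noteq> 0"
    moreover have cone: "v \<in> light_cone" using X_cone[OF L(1)] v by blast
    ultimately have p: "0 < pc v" by (simp add: light_cone_iff)
    define k where "k = \<lfloor>ln (pc v)\<rfloor>"
    have "real_of_int k \<le> ln (pc v)" "ln (pc v) < real_of_int k + 1" by (simp_all add: k_def)
    then have k: "exp (real_of_int k) \<le> pc v" "pc v < exp (real_of_int k + 1)"
      using p exp_le_cancel_iff[of "real_of_int k" "ln (pc v)"] exp_less_cancel_iff[of "ln (pc v)" "real_of_int k + 1"]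
      by simp_all
    have "0 < s / pc v" using p \<open>0 < s\<close> by simp
    \<comment> \<open>A shear parameter near -y / p brings y + p d close to 0.\<close>
    then obtain d where d: "d \<in> D" "d \<in> ball (- ((1 / pc v) *\<^sub>R yc v)) (s / pc v)"
      using D(2)[OF open_ball] by (metis ball_eq_empty not_le)
    have "yc v + pc v *\<^sub>R d = pc v *\<^sub>R (d + (1 / pc v) *\<^sub>R yc v)"
      using p by (simp add: algebra_simps)
    then have "norm (yc v + pc v *\<^sub>R d) = pc v * norm (d + (1 / pc v) *\<^sub>R yc v)" using p by simp
    also have "norm (d + (1 / pc v) *\<^sub>R yc v) < s / pc v"
      using d(2) by (simp add: dist_norm norm_minus_commute)
    finally have "norm (yc v + pc v *\<^sub>R d) < s" using p by simp
    then have "v \<in> shell d s (exp (real_of_int k)) (exp (real_of_int k + 1)) \<inter> L"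
      using k cone v by (simp add: shell_def)
    moreover have "finite (shell d s (exp (real_of_int k)) (exp (real_of_int k + 1)) \<inter> L)"
      by (rule finite_shell_X[OF L(1)]) simp
    ultimately show False using L(2)[OF d(1), of k] by (auto simp: hits_def)
  qed
  obtain g where g: "g \<in> G_Q" "L = translate g Lambda0" using L(1) by (auto simp: X_space_def)
  \<comment> \<open>The parameter 2 makes (p + q) / 2 and (p - q) / 2 integers.\<close>
  define x y :: "'n vec2" where "x = light_vec 2 0 0" and "y = light_vec 0 2 0"
  have cone: "x \<in> light_cone" "y \<in> light_cone" by (simp_all add: light_cone_iff x_def y_def)
  moreover have "x $ i \<in> \<int>" "y $ i \<in> \<int>" for i
    by (auto simp: x_def y_def light_vec_def split: option.split)
  moreover have "x $ None > 0" "y $ None > 0" by (simp_all add: x_def y_def light_vec_def)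
  ultimately have "x \<in> Lambda0" "y \<in> Lambda0" by (simp_all add: Lambda0_def)
  then have "pc (g *v x) = 0" "pc (g *v y) = 0" by (auto intro!: pc0 simp: g translate_def)
  moreover have "x \<noteq> 0" by (simp add: x_def light_coord_eq_iff)
  ultimately obtain k where "y = k *\<^sub>R x" using collinear_of_pc_eq_0[OF g(1) cone] by blast
  then show False by (simp add: x_def y_def light_coord_eq_iff)
qed

text \<open>Obtained by integrating the orbit sum \<open>fwd 0 s N\<close> over X: the boost
  preserves \<open>mu\<close>, so every step contributes \<open>shell_mass s\<close>.\<close>

lemma measure_shell_exp: "measure lam (shell 0 s 1 (exp (real N))) = real N * shell_mass s"
proof (induction N)
  case 0
  then show ?case by (simp add: shell_empty)
next
  case (Suc N)
  interpret T: measure_preserving_map mu "translate (boost (- 1))"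
    by (rule measure_preserving_translate[OF boost_G])
  have int: "integrable mu (fwd 0 s N)" "(\<integral>L. fwd 0 s N L \<partial>mu) = measure lam (shell 0 s 1 (exp (real N)))" for N
    unfolding fwd_def[abs_def] by (intro integrable_hits integral_hits shell_sets_lam bounded_shell; simp)+
  have [measurable]: "fwd 0 s N \<in> borel_measurable mu" using int(1) by blast
  let ?F = "hits (shell 0 s 1 (exp 1)) :: 'n vec2 set \<Rightarrow> real"
  have "measure lam (shell 0 s 1 (exp (real (Suc N)))) = (\<integral>L. fwd 0 s (Suc N) L \<partial>mu)"
    by (simp only: int)
  also have "\<dots> = (\<integral>L. ?F L + fwd 0 s N (translate (boost (- 1)) L) \<partial>mu)"
  proof (rule Bochner_Integration.integral_cong[OF refl])
    fix L assume "L \<in> space mu"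
    then have L: "L \<in> X_space" by (simp add: space_mu)
    show "fwd 0 s (Suc N) L = ?F L + fwd 0 s N (translate (boost (- 1)) L)"
      by (simp only: orbit_sum_fwd[symmetric] orbit_sum_Suc L translate_X_space[OF boost_G L])
  qed
  also have "\<dots> = (\<integral>L. ?F L \<partial>mu) + (\<integral>L. fwd 0 s N (translate (boost (- 1)) L) \<partial>mu)"
    by (intro Bochner_Integration.integral_add integrable_hits shell_sets_lam bounded_shell
        T.integrable_comp_T int) simp
  also have "\<dots> = shell_mass s + real N * shell_mass s"
    by (simp add: T.integral_comp_T int Suc shell_mass_def integral_hits[OF shell_sets_lam bounded_shell])
  finally show ?case by (simp add: algebra_simps)
qed

text \<open>The loss of radius in \<open>AE_fwd_lower\<close> and \<open>AE_fwd_upper\<close> is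
  removed by continuity of \<open>shell_mass\<close>, from the left for lower bounds and from the
  right for upper ones. Rational slopes leave countably many null sets.\<close>

lemma AE_fwd_tendsto:
  assumes "0 < s"
  shows "AE L in mu. (\<lambda>N. fwd 0 s N L / real N) \<longlonglongrightarrow> shell_mass s"
proof -
  have lower: "AE L in mu. \<not> unbounded_above (\<lambda>N. of_rat q * real N - fwd 0 s N L)" if "of_rat q < shell_mass s" for q
  proof -
    have "\<forall>\<^sub>F n in sequentially. of_rat q < shell_mass (s - inverse (real (Suc n)))"
      by (rule order_tendstoD(1)[OF shell_mass_left that])
    moreover have "\<forall>\<^sub>F n in sequentially. inverse (real (Suc n)) < s"
      using order_tendstoD(2)[OF LIMSEQ_inverse_real_of_nat assms] .
    ultimately have "\<forall>\<^sub>F n in sequentially. of_rat q < shell_mass (s - inverse (real (Suc n))) \<and> inverse (real (Suc n)) < s"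
      by (rule eventually_conj)
    then obtain n where "of_rat q < shell_mass (s - inverse (real (Suc n)))" "inverse (real (Suc n)) < s"
      using eventually_happens by fastforce
    then show ?thesis using AE_fwd_lower[of "s - inverse (real (Suc n))" s "of_rat q"] by simp
  qed
  have upper: "AE L in mu. \<not> unbounded_above (\<lambda>N. fwd 0 s N L - of_rat q * real N)" if "shell_mass s < of_rat q" for q
  proof -
    have "\<forall>\<^sub>F n in sequentially. shell_mass (s + inverse (real (Suc n))) < of_rat q"
      by (rule order_tendstoD(2)[OF shell_mass_right that])
    then obtain n where "shell_mass (s + inverse (real (Suc n))) < of_rat q"
      using eventually_happens by fastforce
    then show ?thesis using AE_fwd_upper[OF assms, of "s + inverse (real (Suc n))" "of_rat q"] by simp
  qed
  have "AE L in mu. (\<forall>q. of_rat q < shell_mass s \<longrightarrow> \<not> unbounded_above (\<lambda>N. of_rat q * real N - fwd 0 s N L)) \<and>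
      (\<forall>q. shell_mass s < of_rat q \<longrightarrow> \<not> unbounded_above (\<lambda>N. fwd 0 s N L - of_rat q * real N))"
    unfolding AE_all_countable AE_conj_iff using lower upper by auto
  then show ?thesis
  proof (rule AE_mp[OF _ AE_I2], intro impI)
    fix L assume L: "(\<forall>q. of_rat q < shell_mass s \<longrightarrow> \<not> unbounded_above (\<lambda>N. of_rat q * real N - fwd 0 s N L)) \<and>
      (\<forall>q. shell_mass s < of_rat q \<longrightarrow> \<not> unbounded_above (\<lambda>N. fwd 0 s N L - of_rat q * real N))"
    show "(\<lambda>N. fwd 0 s N L / real N) \<longlonglongrightarrow> shell_mass s"
    proof (rule order_tendstoI)
      fix a assume "a < shell_mass s"
      then obtain q where q: "a < of_rat q" "of_rat q < shell_mass s" using of_rat_dense by blast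
      then have "\<not> unbounded_above (\<lambda>N. of_rat q * real N - fwd 0 s N L)" using L by blast
      then obtain K :: nat where K: "\<And>N. of_rat q * real N - fwd 0 s N L \<le> real K"
        by (auto simp: unbounded_above_def not_less)
      obtain M :: nat where M: "real K / (of_rat q - a) < real M" using reals_Archimedean2 by blast
      have "a < fwd 0 s N L / real N" if "M < N" for N
      proof -
        have "real K < (of_rat q - a) * real M"
          using M q by (simp add: pos_divide_less_eq mult.commute)
        also have "\<dots> \<le> (of_rat q - a) * real N"
          using that q by (intro mult_left_mono) auto
        finally have "real K < (of_rat q - a) * real N" .
        then have "a * real N < fwd 0 s N L" using K[of N] by (simp add: algebra_simps)
        then show ?thesis using that by (simp add: field_simps)
      qed
      then show "\<forall>\<^sub>F N in sequentially. a < fwd 0 s N L / real N"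
        using eventually_gt_at_top[of M] by (rule eventually_mono[rotated]) blast
    next
      fix a assume "shell_mass s < a"
      then obtain q where q: "shell_mass s < of_rat q" "of_rat q < a" using of_rat_dense by blast
      then have "\<not> unbounded_above (\<lambda>N. fwd 0 s N L - of_rat q * real N)" using L by blast
      then obtain K :: nat where K: "\<And>N. fwd 0 s N L - of_rat q * real N \<le> real K"
        by (auto simp: unbounded_above_def not_less)
      obtain M :: nat where M: "real K / (a - of_rat q) < real M" using reals_Archimedean2 by blast
      have "fwd 0 s N L / real N < a" if "M < N" for N
      proof -
        have "real K < (a - of_rat q) * real M"
          using M q by (simp add: pos_divide_less_eq mult.commute)
        also have "\<dots> \<le> (a - of_rat q) * real N"
          using that q by (intro mult_left_mono) auto
        finally have "real K < (a - of_rat q) * real N" .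
        then have "fwd 0 s N L < a * real N" using K[of N] by (simp add: algebra_simps)
        then show ?thesis using that by (simp add: field_simps)
      qed
      then show "\<forall>\<^sub>F N in sequentially. fwd 0 s N L / real N < a"
        using eventually_gt_at_top[of M] by (rule eventually_mono[rotated]) blast
    qed
  qed
qed

end

text \<open>Monotonicity squeezes f T / V T between quotients of values at the integers N <= T <= N
  + 1, and (N + 1) / N tends to 1.\<close>

lemma ratio_tendsto_1:
  fixes f V :: "real \<Rightarrow> real"
  assumes "mono f" "mono V" and f0: "\<And>T. 0 \<le> f T"
    and f: "(\<lambda>N. f (real N) / real N) \<longlonglongrightarrow> \<psi>" and V: "\<And>N. V (real N) = real N * \<psi>" and "0 < \<psi>"
  shows "((\<lambda>T. f T / V T) \<longlongrightarrow> 1) at_top"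
proof -
  let ?n = "\<lambda>T::real. nat \<lfloor>T\<rfloor>"
  have n: "filterlim ?n sequentially at_top"
    by (rule filterlim_compose[OF filterlim_nat_sequentially filterlim_floor_sequentially])
  have f1: "(\<lambda>N. f (real (Suc N)) / real (Suc N)) \<longlonglongrightarrow> \<psi>"
    using LIMSEQ_Suc[OF f] .
  have r: "(\<lambda>N. real N / real (Suc N)) \<longlonglongrightarrow> 1" by (rule LIMSEQ_n_over_Suc_n)
  have r': "(\<lambda>N. real (Suc N) / real N) \<longlonglongrightarrow> 1" by (rule LIMSEQ_Suc_n_over_n)
  have "(\<lambda>N. (f (real N) / real N) * (real N / real (Suc N)) / \<psi>) \<longlonglongrightarrow> \<psi> * 1 / \<psi>"
    by (intro tendsto_intros f r) (use \<open>0 < \<psi>\<close> in simp)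
  then have lo: "(\<lambda>N. (f (real N) / real N) * (real N / real (Suc N)) / \<psi>) \<longlonglongrightarrow> 1"
    using \<open>0 < \<psi>\<close> by simp
  have "(\<lambda>N. (f (real (Suc N)) / real (Suc N)) * (real (Suc N) / real N) / \<psi>) \<longlonglongrightarrow> \<psi> * 1 / \<psi>"
    by (intro tendsto_intros f1 r') (use \<open>0 < \<psi>\<close> in simp)
  then have hi: "(\<lambda>N. (f (real (Suc N)) / real (Suc N)) * (real (Suc N) / real N) / \<psi>) \<longlonglongrightarrow> 1"
    using \<open>0 < \<psi>\<close> by simp
  have bounds: "(f (real (?n T)) / real (?n T)) * (real (?n T) / real (Suc (?n T))) / \<psi> \<le> f T / V T \<and>
      f T / V T \<le> (f (real (Suc (?n T))) / real (Suc (?n T))) * (real (Suc (?n T)) / real (?n T)) / \<psi>"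
    if "1 \<le> T" for T
  proof -
    let ?N = "?n T"
    \<comment> \<open>From T >= 1 the integer part is positive, so no denominator below
      vanishes.\<close>
    have N: "real ?N \<le> T" "T \<le> real (Suc ?N)" "0 < real ?N" using that by linarith+
    have "f (real ?N) \<le> f T" "f T \<le> f (real (Suc ?N))" "V (real ?N) \<le> V T" "V T \<le> V (real (Suc ?N))"
      using assms(1,2) N by (auto intro: monoD)
    then have b: "f (real ?N) \<le> f T" "f T \<le> f (real (Suc ?N))" "real ?N * \<psi> \<le> V T" "V T \<le> real (Suc ?N) * \<psi>"
      by (simp_all only: V)
    have pos: "0 < real ?N * \<psi>" using N \<open>0 < \<psi>\<close> by simp
    have "f (real ?N) / (real (Suc ?N) * \<psi>) \<le> f T / V T"
      using b pos f0 by (intro frac_le) auto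
    moreover have "f T / V T \<le> f (real (Suc ?N)) / (real ?N * \<psi>)"
      using b pos f0 by (intro frac_le) auto
    moreover have eq: "x / real n * (real n / m) / \<psi> = x / (m * \<psi>)"
      "x / m * (m / real n) / \<psi> = x / (real n * \<psi>)" if "real n \<noteq> 0" "m \<noteq> 0" for x m n
      using that by simp_all
    moreover have nz: "real ?N \<noteq> 0" "real (Suc ?N) \<noteq> 0" using N by linarith+
    ultimately show ?thesis unfolding eq(1)[OF nz] eq(2)[OF nz] by blast
  qed
  show ?thesis
  proof (rule tendsto_sandwich)
    show "((\<lambda>T. (f (real (?n T)) / real (?n T)) * (real (?n T) / real (Suc (?n T))) / \<psi>) \<longlongrightarrow> 1) at_top"
      by (rule filterlim_compose[OF lo n])
    show "((\<lambda>T. (f (real (Suc (?n T))) / real (Suc (?n T))) * (real (Suc (?n T)) / real (?n T)) / \<psi>) \<longlongrightarrow> 1) at_top"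
      by (rule filterlim_compose[OF hi n])
    show "\<forall>\<^sub>F T in at_top. (f (real (?n T)) / real (?n T)) * (real (?n T) / real (Suc (?n T))) / \<psi> \<le> f T / V T"
      using eventually_ge_at_top[of 1] by (rule eventually_mono) (use bounds in blast)
    show "\<forall>\<^sub>F T in at_top. f T / V T \<le> (f (real (Suc (?n T))) / real (Suc (?n T))) * (real (Suc (?n T)) / real (?n T)) / \<psi>"
      using eventually_ge_at_top[of 1] by (rule eventually_mono) (use bounds in blast)
  qed
qed

text \<open>On the cone \<open>(v $ None)\<^sup>2 - (v $ Some None)\<^sup>2\<close> = p q =
  |y|^2.\<close>

lemma F_set_eq_shell:
  assumes "0 < c"
  shows "F_set T c = shell 0 c 1 (exp T)"
proof -
  have "(v $ None)\<^sup>2 - (v $ Some None)\<^sup>2 < c\<^sup>2 \<longleftrightarrow> norm (yc v) < c" if "v \<in> light_cone" for v :: "'a vec2"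
  proof -
    have "(v $ None)\<^sup>2 - (v $ Some None)\<^sup>2 = pc v * qc v"
      by (simp add: pc_def qc_def power2_eq_square algebra_simps)
    also have "\<dots> = (norm (yc v))\<^sup>2" using that by (simp add: light_cone_iff power2_norm_eq_inner)
    finally show ?thesis using assms by (auto intro: power_strict_mono power2_less_imp_less)
  qed
  then show ?thesis by (auto simp: F_set_def shell_def pc_def)
qed

theorem theorem2p6:
  fixes c :: real
    and mu :: "'n::finite vec2 set measure"
    and lam :: "'n vec2 measure"
  assumes "c > 0"
    and "invariant_prob_X mu"
    and "invariant_radon_cone lam"
    and "siegel_normalized mu lam"
  shows "AE L in mu.
    ((\<lambda>T. real (card (F_set T c \<inter> L)) / measure lam (F_set T c)) \<longlongrightarrow> 1) at_top"
proof -
  interpret siegel_space mu lam using assms(2-4) by unfold_locales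
  show ?thesis
  proof (rule AE_mp[OF AE_fwd_tendsto[OF assms(1)] AE_I2], intro impI)
    fix L assume "L \<in> space mu" and lim: "(\<lambda>N. fwd 0 c N L / real N) \<longlonglongrightarrow> shell_mass c"
    then have L: "L \<in> X_space" by (simp add: space_mu)
    have "((\<lambda>T. hits (F_set T c) L / measure lam (F_set T c)) \<longlongrightarrow> 1) at_top"
    proof (rule ratio_tendsto_1[where \<psi> = "shell_mass c"])
      show "mono (\<lambda>T. hits (F_set T c) L)"
        unfolding F_set_eq_shell[OF assms(1)]
        by (intro monoI hits_mono shell_mono finite_shell_X L) auto
      \<comment> \<open>\<open>measure\<close> assigns 0 to sets of infinite mass, so monotonicity
        rests on the boundedness of the shells.\<close>
      show "mono (\<lambda>T. measure lam (F_set T c))"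
        unfolding F_set_eq_shell[OF assms(1)]
        using emeasure_bounded_cone[OF lam bounded_shell shell_sets_lam, of 1 0 c]
        by (intro monoI measure_mono_fmeasurable shell_mono shell_sets_lam fmeasurableI) auto
      show "(\<lambda>N. hits (F_set (real N) c) L / real N) \<longlonglongrightarrow> shell_mass c"
        using lim by (simp add: F_set_eq_shell[OF assms(1)] fwd_def)
      show "measure lam (F_set (real N) c) = real N * shell_mass c" for N
        by (simp add: F_set_eq_shell[OF assms(1)] measure_shell_exp)
    qed (use shell_mass_pos assms(1) in \<open>auto simp: hits_def\<close>)
    then show "((\<lambda>T. real (card (F_set T c \<inter> L)) / measure lam (F_set T c)) \<longlongrightarrow> 1) at_top"
      by (simp add: hits_def)
  qed
qed

end
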